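(* Let $A$ be a commutative ring, $F\in\mathrm{Mat}_n(A)$ with $F^2=F$, and let $M$ be the finitely generated projective module image of $F$ in $A^n$. Let $k$ be an integer with $0\le k\le n$. Then $M$ is of rank $k$ if and only if the characteristic polynomial $\det(X\mathrm{I}_n-F)$ of $F$ is equal to $(X-1)^kX^{n-k}$. In this case all minors of order $k+1$ of $F$ are zero.
   Context: A finitely generated projective module $M$ over a nontrivial commutative ring $A$ is said to be of (constant) rank $k$ if, for every matrix $G\in\mathrm{Mat}_m(A)$ (any $m$) with $G^2=G$ and image isomorphic to $M$, the characteristic polynomial $\det(X\mathrm{I}_m-G)$ is equal, up to nilpotent elements of $A$ (i.e. coefficientwise modulo nilpotents), to $(X-1)^kX^{m-k}$ (it is equivalent to require this for one such $G$). By convention, over the trivial ring the trivial module is of constant rank $k$ for every $k\ge0$. *)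

theory Defs
  imports
    "Jordan_Normal_Form.DL_Submatrix"
    "HOL-Combinatorics.Permutations"
    "HOL-Algebra.UnivPoly"
begin

text \<open>
  The ring is a structure \<open>R\<close> with \<open>cring R\<close> rather than a type of class \<open>comm_ring_1\<close>,
  because that class excludes the trivial ring.  Matrices and vectors use the types
  \<open>'a mat\<close> and \<open>'a vec\<close> only as containers (dimensions and entries): all arithmetic is that
  of \<open>R\<close>.
\<close>

section \<open>Matrices over a commutative ring\<close>

definition matrices :: "('a, 'r) ring_scheme \<Rightarrow> nat \<Rightarrow> nat \<Rightarrow> 'a mat set" where
  "matrices R m n = {A \<in> carrier_mat m n. \<forall>i<m. \<forall>j<n. A $$ (i,j) \<in> carrier R}"

definition mat_prod :: "('a, 'r) ring_scheme \<Rightarrow> 'a mat \<Rightarrow> 'a mat \<Rightarrow> 'a mat" where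
  "mat_prod R A B = mat (dim_row A) (dim_col B)
     (\<lambda>(i,j). \<Oplus>\<^bsub>R\<^esub>l\<in>{..<dim_col A}. A $$ (i,l) \<otimes>\<^bsub>R\<^esub> B $$ (l,j))"

definition mat_app :: "('a, 'r) ring_scheme \<Rightarrow> 'a mat \<Rightarrow> 'a vec \<Rightarrow> 'a vec" where
  "mat_app R A v = vec (dim_row A)
     (\<lambda>i. \<Oplus>\<^bsub>R\<^esub>l\<in>{..<dim_col A}. A $$ (i,l) \<otimes>\<^bsub>R\<^esub> v $ l)"

definition projections :: "('a, 'r) ring_scheme \<Rightarrow> nat \<Rightarrow> 'a mat set" where
  "projections R n = {F \<in> matrices R n n. mat_prod R F F = F}"

definition mat_det :: "('a, 'r) ring_scheme \<Rightarrow> 'a mat \<Rightarrow> 'a" where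
  "mat_det R A = (\<Oplus>\<^bsub>R\<^esub>p\<in>{p. p permutes {..<dim_row A}}.
     (if evenperm p then \<one>\<^bsub>R\<^esub> else \<ominus>\<^bsub>R\<^esub> \<one>\<^bsub>R\<^esub>) \<otimes>\<^bsub>R\<^esub>
       (\<Otimes>\<^bsub>R\<^esub>i\<in>{..<dim_row A}. A $$ (i, p i)))"

definition poly_X :: "('a, 'r) ring_scheme \<Rightarrow> nat \<Rightarrow> 'a" where
  "poly_X R = monom (UP R) \<one>\<^bsub>R\<^esub> 1"

definition charpoly :: "('a, 'r) ring_scheme \<Rightarrow> 'a mat \<Rightarrow> nat \<Rightarrow> 'a" where
  "charpoly R A = mat_det (UP R) (mat (dim_row A) (dim_row A)
     (\<lambda>(i,j). (if i = j then poly_X R else \<zero>\<^bsub>UP R\<^esub>) \<ominus>\<^bsub>UP R\<^esub> monom (UP R) (A $$ (i,j)) 0))"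

text \<open>The polynomial $(X-1)^k X^{n-k}$; it is only used when \<open>k \<le> n\<close>.\<close>

definition rank_charpoly :: "('a, 'r) ring_scheme \<Rightarrow> nat \<Rightarrow> nat \<Rightarrow> nat \<Rightarrow> 'a" where
  "rank_charpoly R k n =
     (poly_X R \<ominus>\<^bsub>UP R\<^esub> \<one>\<^bsub>UP R\<^esub>) [^]\<^bsub>UP R\<^esub> k \<otimes>\<^bsub>UP R\<^esub> poly_X R [^]\<^bsub>UP R\<^esub> (n - k)"

definition nilpotent :: "('a, 'r) ring_scheme \<Rightarrow> 'a \<Rightarrow> bool" where
  "nilpotent R a \<longleftrightarrow> (\<exists>e::nat. a [^]\<^bsub>R\<^esub> e = \<zero>\<^bsub>R\<^esub>)"

definition poly_eq_mod_nil ::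
    "('a, 'r) ring_scheme \<Rightarrow> (nat \<Rightarrow> 'a) \<Rightarrow> (nat \<Rightarrow> 'a) \<Rightarrow> bool" where
  "poly_eq_mod_nil R p q \<longleftrightarrow>
     (\<forall>i. nilpotent R (coeff (UP R) p i \<ominus>\<^bsub>R\<^esub> coeff (UP R) q i))"

section \<open>Modules\<close>

text \<open>The fields \<open>mult\<close> and \<open>one\<close> of a module record carry no meaning for modules.\<close>

definition free_mod :: "('a, 'r) ring_scheme \<Rightarrow> nat \<Rightarrow> ('a, 'a vec) module" where
  "free_mod R n = \<lparr>
     carrier = {v \<in> carrier_vec n. \<forall>i<n. v $ i \<in> carrier R},
     mult = undefined,
     one = undefined,
     zero = vec n (\<lambda>i. \<zero>\<^bsub>R\<^esub>),
     add = (\<lambda>v w. vec n (\<lambda>i. v $ i \<oplus>\<^bsub>R\<^esub> w $ i)),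
     smult = (\<lambda>a v. vec n (\<lambda>i. a \<otimes>\<^bsub>R\<^esub> v $ i))\<rparr>"

definition image_mod :: "('a, 'r) ring_scheme \<Rightarrow> 'a mat \<Rightarrow> ('a, 'a vec) module" where
  "image_mod R A = (free_mod R (dim_row A))
     \<lparr>carrier := mat_app R A ` carrier (free_mod R (dim_col A))\<rparr>"

definition mod_hom :: "('a, 'r) ring_scheme \<Rightarrow> ('a, 'b, 'm) module_scheme \<Rightarrow>
    ('a, 'c, 'n) module_scheme \<Rightarrow> ('b \<Rightarrow> 'c) set" where
  "mod_hom R M N = {f \<in> carrier M \<rightarrow> carrier N.
     (\<forall>x\<in>carrier M. \<forall>y\<in>carrier M. f (x \<oplus>\<^bsub>M\<^esub> y) = f x \<oplus>\<^bsub>N\<^esub> f y) \<and>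
     (\<forall>a\<in>carrier R. \<forall>x\<in>carrier M. f (a \<odot>\<^bsub>M\<^esub> x) = a \<odot>\<^bsub>N\<^esub> f x)}"

definition mod_isomorphic :: "('a, 'r) ring_scheme \<Rightarrow> ('a, 'b, 'm) module_scheme \<Rightarrow>
    ('a, 'c, 'n) module_scheme \<Rightarrow> bool" where
  "mod_isomorphic R M N \<longleftrightarrow> (\<exists>f\<in>mod_hom R M N. bij_betw f (carrier M) (carrier N))"

text \<open>Finitely generated projective means: a direct summand, up to isomorphism, of some $R^n$.\<close>

definition fg_projective :: "('a, 'r) ring_scheme \<Rightarrow> ('a, 'b, 'm) module_scheme \<Rightarrow> bool" where
  "fg_projective R M \<longleftrightarrow> module R M \<and>
     (\<exists>n. \<exists>s\<in>mod_hom R M (free_mod R n). \<exists>p\<in>mod_hom R (free_mod R n) M.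
        \<forall>x\<in>carrier M. p (s x) = x)"

text \<open>
  Over the trivial ring every module is trivial, and by convention has constant rank \<open>k\<close>
  for every \<open>k\<close>; hence the hypothesis \<open>\<one> \<noteq> \<zero>\<close> below.  The condition \<open>k \<le> m\<close> ensures that
  $(X-1)^k X^{m-k}$ is meaningful, subtraction on \<open>nat\<close> being truncated.
\<close>

definition constant_rank ::
    "('a, 'r) ring_scheme \<Rightarrow> ('a, 'b, 'm) module_scheme \<Rightarrow> nat \<Rightarrow> bool" where
  "constant_rank R M k \<longleftrightarrow> fg_projective R M \<and>
     (\<one>\<^bsub>R\<^esub> \<noteq> \<zero>\<^bsub>R\<^esub> \<longrightarrow>
       (\<forall>m. \<forall>G\<in>projections R m. mod_isomorphic R (image_mod R G) M \<longrightarrow>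
          k \<le> m \<and> poly_eq_mod_nil R (charpoly R G) (rank_charpoly R k m)))"

end

theory Submission
  imports
    Defs
    "HOL-Library.Poly_Mapping"
    "HOL-Library.Multiset"
    "HOL-Algebra.Free_Abelian_Groups"
    "Jordan_Normal_Form.Determinant"
begin

text \<open>
  Write \<open>\<chi>(F)\<close> for the characteristic polynomial.  An idempotent \<open>F\<close> splits $R^n$ into the image
  and the kernel, so \<open>u(1 - F) + vF\<close> acts as \<open>u\<close> on the kernel and as \<open>v\<close> on the image.  Its
  determinant is a form $\sum_j e_j u^{n-j} v^j$ whose coefficients depend on \<open>F\<close> only
  (\<open>det_pencil\<close>), and it is multiplicative in the pair \<open>(u, v)\<close> (\<open>det_pencil_mult\<close>).
  Multiplicativity makes the $e_j$ orthogonal idempotents (\<open>orthogonal_idempotents\<close>), and \<open>u = v = 1\<close>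
  shows that their sum is \<open>1\<close>; geometrically, $e_j$ cuts out the part of the spectrum where the
  image has rank \<open>j\<close>.  With \<open>u = X\<close>, \<open>v = X - 1\<close> one obtains
  $\chi(F) = \sum_j e_j X^{n-j} (X-1)^j$.

  If \<open>\<chi>(F)\<close> equals $(X-1)^k X^{n-k}$ modulo nilpotents, multiplying by $e_i$ for \<open>i \<noteq> k\<close> and comparing
  one coefficient shows that $e_i$ is nilpotent; a nilpotent idempotent is \<open>0\<close>, so $e_k = 1$ and the
  equality is exact (\<open>rank_determines_idempotents\<close>, \<open>charpoly_eq_rank_poly\<close>).

  Conversely, if the images of \<open>G\<close> and \<open>F\<close> are isomorphic, then \<open>G = PQ\<close> and \<open>F = QP\<close> for rectangular
  \<open>P\<close> and \<open>Q\<close> (\<open>isomorphic_images_factor\<close>), and Sylvester's identity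
  $X^n \chi(PQ) = X^m \chi(QP)$ carries the characteristic polynomial of \<open>F\<close> over to that of \<open>G\<close>
  (\<open>charpoly_factors_swapped\<close>).

  For the minors, let $e_k = 1$ and consider \<open>A = 1 - F + XF\<close>, \<open>B = X(1 - F) + F\<close>.  Then \<open>BA = X\<close> and
  $\det A = X^k$.  A block determinant shows that $X^k \det(TBS)$ is divisible by $X^r$ for every
  \<open>r \<times> n\<close> matrix \<open>T\<close> and \<open>n \<times> r\<close> matrix \<open>S\<close>.  For \<open>r > k\<close> this forces $\det(TBS)$ to vanish at \<open>X = 0\<close>, where
  \<open>B\<close> is \<open>F\<close> (\<open>compression_det_zero\<close>).

  Determinants are computed in a type of class \<open>comm_ring_1\<close>.  Every ring structure \<open>R\<close> is the image of
  such a type, namely of a polynomial ring over the integers, under a homomorphism \<open>h\<close>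
  (\<open>ex_presentation\<close>), and determinants commute with \<open>h\<close>.  Hence matrices over \<open>R\<close> are lifted, polynomial
  identities are proved upstairs, and the relation \<open>FF = F\<close>, which does not lift, is used as a
  congruence between images under \<open>h\<close>.
\<close>

section \<open>Homomorphisms from a ring type to a ring structure\<close>

lemma permutes_nat_less: "p permutes {..<n} \<Longrightarrow> i < n \<Longrightarrow> p i < (n::nat)"
  using permutes_in_image[of p "{..<n}" i] by simp

locale cring_map = cring S for S (structure) +
  fixes h :: "'p::comm_ring_1 \<Rightarrow> 'a"
  assumes closed [simp, intro]: "h x \<in> carrier S"
    and add: "h (x + y) = h x \<oplus> h y"
    and mult: "h (x * y) = h x \<otimes> h y"
    and one: "h 1 = \<one>"
begin

lemma zero: "h 0 = \<zero>"
  using add[of 0 0] by (metis add.l_cancel_one' add_0 closed)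

lemma uminus: "h (- x) = \<ominus> h x"
  using add[of "- x" x] by (simp add: zero minus_equality)

lemma diff: "h (x - y) = h x \<ominus> h y"
  using add[of x "- y"] by (simp add: uminus a_minus_def)

lemma pow: "h (x ^ (k::nat)) = h x [^] k"
  by (induction k) (simp_all add: one mult m_comm)

lemma sum: "finite A \<Longrightarrow> h (sum f A) = (\<Oplus>i\<in>A. h (f i))"
  by (induction A rule: finite_induct) (simp_all add: zero add Pi_def)

lemma prod: "finite A \<Longrightarrow> h (prod f A) = (\<Otimes>i\<in>A. h (f i))"
  by (induction A rule: finite_induct) (simp_all add: one mult Pi_def)

lemma det:
  assumes "A \<in> carrier_mat n n"
  shows "h (det A) = mat_det S (map_mat h A)"
proof -
  have sgn: "h (signof p) = (if evenperm p then \<one> else \<ominus> \<one>)" for p :: "nat \<Rightarrow> nat"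
    by (simp add: sign_def one uminus)
  have fin: "finite {p. p permutes {..<n}}"
    by (simp add: finite_permutations)
  have "h (det A) = (\<Oplus>p\<in>{p. p permutes {..<n}}.
      (if evenperm p then \<one> else \<ominus> \<one>) \<otimes> (\<Otimes>i\<in>{..<n}. h (A $$ (i, p i))))"
    unfolding det_def'[OF assms] atLeast0LessThan
    by (simp only: sum[OF fin] mult prod[OF finite_lessThan] sgn)
  also have "\<dots> = mat_det S (map_mat h A)"
    unfolding mat_det_def using assms
    by (auto intro!: finsum_cong' finprod_cong' m_closed finprod_closed arg_cong2[where f = "(\<otimes>)"] simp: Pi_def dest: permutes_nat_less)
  finally show ?thesis .
qed

lemma det_cong:
  assumes "A \<in> carrier_mat n n" "map_mat h A = map_mat h B"
  shows "h (det A) = h (det B)"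
proof -
  have "B \<in> carrier_mat n n"
    using assms by (metis carrier_matD carrier_matI index_map_mat(2,3))
  then show ?thesis using assms by (simp add: det)
qed

lemma mat_prod:
  assumes "A \<in> carrier_mat m n" "B \<in> carrier_mat n r"
  shows "map_mat h (A * B) = mat_prod S (map_mat h A) (map_mat h B)"
  using assms unfolding mat_prod_def
  by (intro eq_matI) (auto simp: scalar_prod_def sum mult atLeast0LessThan intro!: finsum_cong')

lemma mat_app:
  assumes "A \<in> carrier_mat m n" "v \<in> carrier_vec n"
  shows "map_vec h (A *\<^sub>v v) = mat_app S (map_mat h A) (map_vec h v)"
  using assms unfolding mat_app_def
  by (intro eq_vecI) (auto simp: scalar_prod_def sum mult atLeast0LessThan intro!: finsum_cong')

abbreviation H :: "'p poly \<Rightarrow> nat \<Rightarrow> 'a" where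
  "H p \<equiv> \<lambda>i. h (Polynomial.coeff p i)"

text \<open>
  Applied to this homomorphism, every result about \<open>cring_map\<close> also holds for the univariate polynomials
  over the structure.
\<close>

lemma coefficientwise: "cring_map (UP S) H"
proof -
  interpret P: UP_cring S "UP S" by unfold_locales
  have up: "(\<lambda>i. h (Polynomial.coeff p i)) \<in> up S" for p
  proof (rule mem_upI)
    have "bound \<zero> (degree p) (\<lambda>i. h (Polynomial.coeff p i))"
      by (rule bound.intro) (simp add: coeff_eq_0 zero)
    then show "\<exists>n. bound \<zero> n (\<lambda>i. h (Polynomial.coeff p i))" ..
  qed simp
  show ?thesis
  proof (intro cring_map.intro cring_map_axioms.intro)
    show "cring (UP S)" by (rule P.UP_cring)
  next
    fix p q :: "'p poly"
    show "(\<lambda>i. h (Polynomial.coeff p i)) \<in> carrier (UP S)"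
      using up by (simp add: UP_def)
    show "(\<lambda>i. h (Polynomial.coeff (p + q) i)) =
      (\<lambda>i. h (Polynomial.coeff p i)) \<oplus>\<^bsub>UP S\<^esub> (\<lambda>i. h (Polynomial.coeff q i))"
      using up by (simp add: UP_def add)
    show "(\<lambda>i. h (Polynomial.coeff (p * q) i)) =
      (\<lambda>i. h (Polynomial.coeff p i)) \<otimes>\<^bsub>UP S\<^esub> (\<lambda>i. h (Polynomial.coeff q i))"
      using up by (simp add: UP_def Polynomial.coeff_mult sum mult)
    show "(\<lambda>i. h (Polynomial.coeff (1::'p poly) i)) = \<one>\<^bsub>UP S\<^esub>"
      by (auto simp: UP_def one zero coeff_1)
  qed
qed

end

lemma (in cring) idempotent_nilpotent:
  assumes "nilpotent R x" "x \<in> carrier R" "x \<otimes> x = x" shows "x = \<zero>"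
proof -
  obtain m :: nat where m: "x [^] m = \<zero>" using assms(1) unfolding nilpotent_def by blast
  have "x \<otimes> x [^] k = x" for k :: nat
    using assms(2,3) by (induction k) (simp_all flip: m_assoc)
  from this[of m] show ?thesis using m assms(2) by simp
qed

lemma X_power: "[:0, 1:] ^ n = Polynomial.monom (1::'p::comm_ring_1) n"
  by (simp add: monom_altdef)

text \<open>
  The same polynomial as \<open>rank_charpoly\<close>, but over a ring type.  It vanishes at
  the origin to order exactly \<open>n - k\<close>, and its lowest coefficient is the unit $(-1)^k$; this is what
  separates different ranks.
\<close>

definition rank_poly :: "nat \<Rightarrow> nat \<Rightarrow> 'p::comm_ring_1 poly" where
  "rank_poly k n = [:0, 1:] ^ (n - k) * ([:0, 1:] - 1) ^ k"

lemma coeff_rank_poly_below: "t < n - k \<Longrightarrow> Polynomial.coeff (rank_poly k n) t = 0"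
  by (simp add: rank_poly_def X_power coeff_monom_mult )

lemma coeff_rank_poly_bottom: "Polynomial.coeff (rank_poly k n) (n - k) = (- 1) ^ k"
proof -
  have "poly (([:0, 1:] - 1) ^ k) 0 = (- 1 :: 'a) ^ k" by (simp add: poly_power)
  then show ?thesis
    by (simp add: rank_poly_def X_power coeff_monom_mult poly_0_coeff_0)
qed

context cring_map
begin

lemma up_H: "H p \<in> up S"
  using cring_map.closed[OF coefficientwise, of p] by (simp add: UP_def)

lemma poly_X_eq: "poly_X S = H [:0, 1:]"
proof -
  have "H [:0, 1:] = H (Polynomial.monom 1 1)" using X_power[of 1, where 'p = 'p] by simp
  then show ?thesis by (auto simp: poly_X_def UP_def coeff_monom one zero)
qed

lemma UP_const_eq: "up_ring.monom (UP S) (h a) 0 = H [:a:]"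
  by (auto simp: UP_def zero coeff_pCons split: nat.splits)

lemma charpoly_eq:
  assumes A: "A \<in> carrier_mat n n"
  shows "charpoly S (map_mat h A) = H (det ([:0, 1:] \<cdot>\<^sub>m 1\<^sub>m n - map_mat (\<lambda>a. [:a:]) A))"
proof -
  interpret P: cring_map "UP S" H by (rule coefficientwise)
  have "H (det ([:0, 1:] \<cdot>\<^sub>m 1\<^sub>m n - map_mat (\<lambda>a. [:a:]) A)) =
      mat_det (UP S) (map_mat H ([:0, 1:] \<cdot>\<^sub>m 1\<^sub>m n - map_mat (\<lambda>a. [:a:]) A))"
    using A by (intro P.det[where n = n]) auto
  moreover have "map_mat H ([:0, 1:] \<cdot>\<^sub>m 1\<^sub>m n - map_mat (\<lambda>a. [:a:]) A) =
      mat n n (\<lambda>(i,j). (if i = j then poly_X S else \<zero>\<^bsub>UP S\<^esub>) \<ominus>\<^bsub>UP S\<^esub>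
        up_ring.monom (UP S) (map_mat h A $$ (i,j)) 0)"
  proof (rule eq_matI, goal_cases)
    case (1 i j)
    then have ij: "i < n" "j < n" by simp_all
    have "(x \<cdot>\<^sub>m 1\<^sub>m n - map_mat (\<lambda>a. [:a:]) A) $$ (i, j) = (if i = j then x else 0) - [:A $$ (i, j):]"
      for x :: "'p poly" using ij A by simp
    then have "map_mat H ([:0, 1:] \<cdot>\<^sub>m 1\<^sub>m n - map_mat (\<lambda>a. [:a:]) A) $$ (i, j) =
        H (if i = j then [:0, 1:] else 0) \<ominus>\<^bsub>UP S\<^esub> H [:A $$ (i, j):]"
      using ij A by (simp only: index_map_mat index_minus_mat carrier_matD P.diff)
    then show ?case
      using ij A by (simp only: index_mat split poly_X_eq UP_const_eq P.zero index_map_mat carrier_matD if_distrib[of H])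
  qed (use A in auto)
  ultimately show ?thesis
    using A by (simp add: charpoly_def)
qed

lemma rank_charpoly_eq: "rank_charpoly S k n = H (rank_poly k n)"
proof -
  interpret P: cring_map "UP S" H by (rule coefficientwise)
  have "H (rank_poly k n) = H (([:0, 1:] - 1) ^ k * [:0, 1:] ^ (n - k))"
    by (simp add: rank_poly_def mult.commute)
  also have "\<dots> = rank_charpoly S k n"
    unfolding rank_charpoly_def poly_X_eq P.mult P.pow P.diff P.one ..
  finally show ?thesis ..
qed

lemma nilpotent_mult:
  assumes "nilpotent S (h x)" shows "nilpotent S (h (x * y))"
proof -
  obtain m :: nat where "h x [^] m = \<zero>" using assms unfolding nilpotent_def by blast
  then have "h (x * y) [^] m = \<zero>" by (simp add: mult nat_pow_distrib)
  then show ?thesis unfolding nilpotent_def by blast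
qed

lemma poly_eq_mod_nil_H:
  "poly_eq_mod_nil S (H p) (H q) \<longleftrightarrow> (\<forall>t. nilpotent S (h (Polynomial.coeff (p - q) t)))"
  using up_H[of p] up_H[of q] by (simp add: poly_eq_mod_nil_def UP_def diff)

end

section \<open>Presentation of a commutative ring\<close>

text \<open>
  Multisets over the carrier type are the monomials in one variable per element.  Elements outside the carrier
  are evaluated to \<open>\<one>\<close>, so that evaluation is a total monoid homomorphism.
\<close>

lemma (in cring) ex_multiset_prod:
  "\<exists>v::'a multiset \<Rightarrow> 'a. (\<forall>M. v M \<in> carrier R) \<and> v {#} = \<one> \<and>
     (\<forall>M N. v (M + N) = v M \<otimes> v N) \<and> (\<forall>a\<in>carrier R. v {#a#} = a)"
proof -
  define f where "f a x = (if a \<in> carrier R \<and> x \<in> carrier R then a \<otimes> x else x)" for a x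
  interpret comp_fun_commute f
    by standard (auto simp: f_def fun_eq_iff m_lcomm)
  define v where "v = fold_mset f \<one>"
  have step: "v (add_mset a K) = f a (v K)" for a K by (simp add: v_def)
  have closed: "v M \<in> carrier R" for M
  proof (induction M)
    case (add a M)
    then show ?case by (simp add: step f_def)
  qed (simp add: v_def)
  have add: "v (M + N) = v M \<otimes> v N" for M N
  proof (induction M)
    case empty
    then show ?case using closed by (simp add: v_def)
  next
    case (add a M)
    from add show ?case
      using closed by (auto simp: step f_def m_assoc)
  qed
  have "v {#a#} = a" if "a \<in> carrier R" for a
    using that by (simp add: v_def f_def)
  then show ?thesis using closed add by (intro exI[of _ v]) (auto simp: v_def)
qed

text \<open>
  The source is the monoid ring of the multisets over the integers, that is, the polynomial ring with one variable
  for each \<open>a\<close>; the variable of a ring element \<open>a\<close> is sent to \<open>a\<close>.  Additively it is a free abelian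
  group, which gives \<open>h\<close>; multiplicativity is inherited from the monomials by bilinearity.
\<close>

theorem (in cring) ex_presentation:
  "\<exists>h::('a multiset \<Rightarrow>\<^sub>0 int) \<Rightarrow> 'a. cring_map R h \<and> range h = carrier R"
proof -
  obtain v :: "'a multiset \<Rightarrow> 'a" where v: "\<And>M. v M \<in> carrier R" "v {#} = \<one>"
    "\<And>M N. v (M + N) = v M \<otimes> v N" "\<And>a. a \<in> carrier R \<Longrightarrow> v {#a#} = a"
    using ex_multiset_prod by blast
  obtain h where hom: "h \<in> hom (free_Abelian_group UNIV) (add_monoid R)"
    and gen: "\<And>M. h (frag_of M) = v M"
    using comm_group.free_Abelian_group_universal[OF a_comm_group, of v UNIV] v(1) by auto
  have closed: "h x \<in> carrier R" for x
    using hom by (auto simp: hom_def free_Abelian_group_def)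
  have add: "h (x + y) = h x \<oplus> h y" for x y
    using hom by (auto simp: hom_def free_Abelian_group_def)
  have zero: "h 0 = \<zero>"
    using add[of 0 0] closed by (metis add.l_cancel_one' add_0)
  have diff: "h (x - y) = h x \<ominus> h y" for x y
    using add[of "x - y" y] closed[of x] closed[of y] closed[of "x - y"]
    by (simp add: a_minus_def a_assoc r_neg)
  have gen_mult: "h (frag_of M * y) = v M \<otimes> h y" for M y
  proof -
    have "Poly_Mapping.keys y \<subseteq> UNIV" by simp
    then show ?thesis
    proof (induction y rule: frag_induction)
      case zero
      then show ?case by (simp add: \<open>h 0 = \<zero>\<close> v)
    next
      case (one N)
      then show ?case by (simp add: mult_single gen v)
    next
      case (diff a b)
      then show ?case by (simp add: \<open>\<And>x y. h (x - y) = h x \<ominus> h y\<close> right_diff_distrib v closed r_minus r_distr a_minus_def)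
    qed
  qed
  have mult: "h (x * y) = h x \<otimes> h y" for x y
  proof -
    have "Poly_Mapping.keys x \<subseteq> UNIV" by simp
    then show ?thesis
    proof (induction x rule: frag_induction)
      case zero
      then show ?case by (simp add: \<open>h 0 = \<zero>\<close> closed)
    next
      case (one N)
      then show ?case by (simp add: gen_mult gen)
    next
      case (diff a b)
      then show ?case by (simp add: \<open>\<And>x y. h (x - y) = h x \<ominus> h y\<close> left_diff_distrib closed l_minus l_distr a_minus_def)
    qed
  qed
  have "h 1 = \<one>" using gen[of "{#}"] v(2) by (simp flip: single_one)
  then have "cring_map R h"
    using closed add mult by unfold_locales auto
  moreover have "a \<in> range h" if "a \<in> carrier R" for a
    using gen[of "{#a#}"] v(4)[OF that] by (metis rangeI)
  ultimately show ?thesis using closed by blast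
qed

section \<open>Determinants of block matrices\<close>

lemma det_four_block_one_zero:
  fixes D :: "'p::comm_ring_1 mat"
  assumes "B \<in> carrier_mat n m" "D \<in> carrier_mat m m"
  shows "det (four_block_mat (1\<^sub>m n) B (0\<^sub>m m n) D) = det D"
  using assms(1)
proof (induction n arbitrary: B)
  case 0
  then have "four_block_mat (1\<^sub>m 0) B (0\<^sub>m m 0) D = D"
    using assms(2) by (intro eq_matI) auto
  then show ?case by simp
next
  case (Suc n)
  let ?M = "four_block_mat (1\<^sub>m (Suc n)) B (0\<^sub>m m (Suc n)) D"
  let ?B = "mat n m (\<lambda>(i,j). B $$ (Suc i, j))"
  have M: "?M \<in> carrier_mat (Suc n + m) (Suc n + m)"
    using assms(2) by (intro four_block_carrier_mat) auto
  have entry: "?M $$ (i, 0) = (if i = 0 then 1 else 0)" if "i < Suc n + m" for i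
    using that Suc.prems assms(2) by auto
  have del: "mat_delete ?M 0 0 = four_block_mat (1\<^sub>m n) ?B (0\<^sub>m m n) D"
    using Suc.prems assms(2) by (intro eq_matI) (auto simp: mat_delete_def Suc_diff_le)
  have "det ?M = (\<Sum>i<Suc n + m. ?M $$ (i, 0) * cofactor ?M i 0)"
    by (rule laplace_expansion_column[OF M]) simp
  also have "\<dots> = (\<Sum>i<Suc n + m. if i = 0 then cofactor ?M i 0 else 0)"
    by (intro sum.cong refl) (simp add: entry del: index_mat_four_block)
  also have "\<dots> = cofactor ?M 0 0"
    by (subst sum.delta) auto
  also have "\<dots> = det (mat_delete ?M 0 0)"
    by (simp add: cofactor_def)
  also have "\<dots> = det D" unfolding del by (rule Suc.IH) simp
  finally show ?case .
qed

lemma det_four_block_zero_one: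
  fixes A :: "'p::comm_ring_1 mat"
  assumes "A \<in> carrier_mat n n" "B \<in> carrier_mat n m"
  shows "det (four_block_mat A B (0\<^sub>m m n) (1\<^sub>m m)) = det A"
  using assms(2)
proof (induction m arbitrary: B)
  case 0
  then have "four_block_mat A B (0\<^sub>m 0 n) (1\<^sub>m 0) = A"
    using assms(1) by (intro eq_matI) auto
  then show ?case by simp
next
  case (Suc m)
  let ?M = "four_block_mat A B (0\<^sub>m (Suc m) n) (1\<^sub>m (Suc m))"
  let ?B = "mat n m (\<lambda>(i,j). B $$ (i, j))"
  have M: "?M \<in> carrier_mat (n + Suc m) (n + Suc m)"
    using assms(1) by (intro four_block_carrier_mat) auto
  have entry: "?M $$ (n + m, j) = (if j = n + m then 1 else 0)" if "j < n + Suc m" for j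
    using that Suc.prems assms(1) by auto
  have del: "mat_delete ?M (n + m) (n + m) = four_block_mat A ?B (0\<^sub>m m n) (1\<^sub>m m)"
    using Suc.prems assms(1) by (intro eq_matI) (auto simp: mat_delete_def)
  have "det ?M = (\<Sum>j<n + Suc m. ?M $$ (n + m, j) * cofactor ?M (n + m) j)"
    by (rule laplace_expansion_row[OF M]) simp
  also have "\<dots> = (\<Sum>j<n + Suc m. if j = n + m then cofactor ?M (n + m) j else 0)"
    by (intro sum.cong refl) (simp add: entry del: index_mat_four_block)
  also have "\<dots> = cofactor ?M (n + m) (n + m)"
    by (subst sum.delta) auto
  also have "\<dots> = det (mat_delete ?M (n + m) (n + m))"
    by (simp add: cofactor_def mult_2[symmetric] power_mult)
  also have "\<dots> = det A" unfolding del by (rule Suc.IH) simp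
  finally show ?case .
qed

text \<open>
  Over a ring with zero divisors row reduction is not available; instead the matrix is factored into two block
  matrices with an identity block each, and these are expanded along the rows and columns of the identity.
\<close>

lemma det_four_block_lower_left_zero:
  fixes A :: "'p::comm_ring_1 mat"
  assumes A: "A \<in> carrier_mat n n" and B: "B \<in> carrier_mat n m" and D: "D \<in> carrier_mat m m"
  shows "det (four_block_mat A B (0\<^sub>m m n) D) = det A * det D"
proof -
  let ?U = "four_block_mat (1\<^sub>m n) (0\<^sub>m n m) (0\<^sub>m m n) D"
  let ?V = "four_block_mat A B (0\<^sub>m m n) (1\<^sub>m m)"
  have "?U * ?V = four_block_mat A B (0\<^sub>m m n) D"
    using assms by (subst mult_four_block_mat[where ?nc1.0 = n and ?nc2.0 = m]) auto
  moreover have "det (?U * ?V) = det ?U * det ?V"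
    by (rule det_mult[where n = "n + m"]) (use assms in auto)
  ultimately show ?thesis
    using det_four_block_one_zero[OF zero_carrier_mat D] det_four_block_zero_one[OF A B]
    by (simp add: mult.commute)
qed

lemma det_four_block_upper_right_zero:
  fixes A :: "'p::comm_ring_1 mat"
  assumes A: "A \<in> carrier_mat n n" and C: "C \<in> carrier_mat m n" and D: "D \<in> carrier_mat m m"
  shows "det (four_block_mat A (0\<^sub>m n m) C D) = det A * det D"
proof -
  let ?M = "four_block_mat A (0\<^sub>m n m) C D"
  have M: "?M \<in> carrier_mat (n + m) (n + m)"
    using A D by simp
  have t: "transpose_mat ?M =
      four_block_mat (transpose_mat A) (transpose_mat C) (0\<^sub>m m n) (transpose_mat D)"
    using assms by (subst transpose_four_block_mat) auto
  have "det ?M = det (transpose_mat ?M)" using det_transpose[OF M] by simp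
  also have "\<dots> = det (transpose_mat A) * det (transpose_mat D)"
    unfolding t using assms by (intro det_four_block_lower_left_zero) auto
  finally show ?thesis using det_transpose[OF A] det_transpose[OF D] by simp
qed

text \<open>
  Both sides are computed from the block matrix with rows \<open>(x, P)\<close> and \<open>(Q, 1)\<close>: clearing \<open>P\<close> gives
  \<open>x - PQ\<close> on the diagonal, clearing \<open>Q\<close> after multiplication of the second row by \<open>x\<close> gives
  \<open>x - QP\<close>.
\<close>

lemma sylvester_det:
  fixes x :: "'p::comm_ring_1"
  assumes P: "P \<in> carrier_mat m n" and Q: "Q \<in> carrier_mat n m"
  shows "x ^ n * det (x \<cdot>\<^sub>m 1\<^sub>m m - P * Q) = x ^ m * det (x \<cdot>\<^sub>m 1\<^sub>m n - Q * P)"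
proof -
  let ?M = "four_block_mat (x \<cdot>\<^sub>m 1\<^sub>m m) P Q (1\<^sub>m n)"
  let ?U = "four_block_mat (1\<^sub>m m) (- P) (0\<^sub>m n m) (1\<^sub>m n)"
  let ?V = "four_block_mat (1\<^sub>m m) (0\<^sub>m m n) (- Q) (x \<cdot>\<^sub>m 1\<^sub>m n)"
  have M: "?M \<in> carrier_mat (m + n) (m + n)" by simp
  have PQ: "P * Q \<in> carrier_mat m m" and QP: "Q * P \<in> carrier_mat n n" using P Q by auto
  have UM: "?U * ?M = four_block_mat (x \<cdot>\<^sub>m 1\<^sub>m m - P * Q) (0\<^sub>m m n) Q (1\<^sub>m n)"
    using P Q PQ
    by (subst mult_four_block_mat[where ?nc1.0 = m and ?nc2.0 = n]) 
       (auto intro!: cong_four_block_mat eq_matI)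
  have VM: "?V * ?M = four_block_mat (x \<cdot>\<^sub>m 1\<^sub>m m) P (0\<^sub>m n m) (x \<cdot>\<^sub>m 1\<^sub>m n - Q * P)"
    using P Q QP
    by (subst mult_four_block_mat[where ?nc1.0 = m and ?nc2.0 = n])
       (auto intro!: cong_four_block_mat eq_matI)
  have "det ?U * det ?M = det (?U * ?M)"
    using P by (intro det_mult[symmetric, where n = "m + n"]) auto
  also have "\<dots> = det (x \<cdot>\<^sub>m 1\<^sub>m m - P * Q)"
    unfolding UM using P Q by (subst det_four_block_upper_right_zero) auto
  finally have 1: "det ?M = det (x \<cdot>\<^sub>m 1\<^sub>m m - P * Q)"
    using P by (subst (asm) det_four_block_lower_left_zero) auto
  have "det ?V * det ?M = det (?V * ?M)"
    using Q by (intro det_mult[symmetric, where n = "m + n"]) auto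
  also have "\<dots> = x ^ m * det (x \<cdot>\<^sub>m 1\<^sub>m n - Q * P)"
    unfolding VM using P Q by (subst det_four_block_lower_left_zero) auto
  finally have 2: "x ^ n * det ?M = x ^ m * det (x \<cdot>\<^sub>m 1\<^sub>m n - Q * P)"
    using Q by (subst (asm) det_four_block_upper_right_zero) auto
  show ?thesis using 1 2 by simp
qed

context cring_map
begin

text \<open>
  After Sylvester's identity it remains to cancel $X^n$.  The bound \<open>k \<le> m\<close> comes out of the same identity:
  otherwise the lowest coefficient of $X^{m+n-k}(X-1)^k$, a unit, would be a coefficient of a multiple of
  $X^n$ below degree \<open>n\<close>.
\<close>

lemma charpoly_factors_swapped:
  assumes P: "P \<in> carrier_mat m n" and Q: "Q \<in> carrier_mat n m" and k: "k \<le> n"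
    and one: "\<one> \<noteq> \<zero>"
    and QP: "charpoly S (map_mat h (Q * P)) = rank_charpoly S k n"
  shows "k \<le> m \<and> charpoly S (map_mat h (P * Q)) = rank_charpoly S k m"
proof -
  interpret P: cring_map "UP S" H by (rule coefficientwise)
  let ?C = "map_mat (\<lambda>a. [:a:])"
  define c where "c = det ([:0, 1:] \<cdot>\<^sub>m 1\<^sub>m m - ?C (P * Q))"
  define d where "d = det ([:0, 1:] \<cdot>\<^sub>m 1\<^sub>m n - ?C (Q * P))"
  interpret C: comm_ring_hom "\<lambda>a::'p. [:a:]"
    by unfold_locales (auto simp: one_pCons)
  have syl: "[:0, 1:] ^ n * c = [:0, 1:] ^ m * d"
    unfolding c_def d_def C.mat_hom_mult[OF P Q] C.mat_hom_mult[OF Q P]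
    by (rule sylvester_det) (use P Q in auto)
  have c: "charpoly S (map_mat h (P * Q)) = H c" and d: "charpoly S (map_mat h (Q * P)) = H d"
    unfolding c_def d_def by (rule charpoly_eq; use P Q in simp)+
  have Hd: "H d = H (rank_poly k n)" using QP unfolding d rank_charpoly_eq .
  have eq: "H ([:0, 1:] ^ n * c) = H ([:0, 1:] ^ m * rank_poly k n)"
    unfolding syl using Hd by (simp only: P.mult)
  have shift: "Polynomial.coeff ([:0, 1:] ^ a * p) t = (if t < a then 0 else Polynomial.coeff p (t - a))"
    for a t and p :: "'p poly"
    unfolding X_power by (simp add: coeff_monom_mult)
  have km: "k \<le> m"
  proof (rule ccontr)
    assume "\<not> k \<le> m"
    then have t: "m + (n - k) < n" using k by simp
    have "h ((- 1) ^ k) = \<zero>"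
      using fun_cong[OF eq, of "m + (n - k)"] t
      unfolding shift by (simp add: coeff_rank_poly_bottom zero)
    then have "h ((- 1) ^ k * (- 1) ^ k) = \<zero>" by (simp only: mult r_null zero_closed)
    then show False using \<open>\<one> \<noteq> \<zero>\<close> by (simp add: cring_map.one[OF cring_map_axioms] flip: power_mult_distrib)
  qed
  then have regroup: "[:0, 1:] ^ m * rank_poly k n = [:0, 1:] ^ n * (rank_poly k m :: 'p poly)"
    using k by (simp add: rank_poly_def mult.assoc[symmetric] add.commute[of m n] flip: power_add)
  have "H c t = H (rank_poly k m) t" for t
    using fun_cong[OF eq[unfolded regroup], of "n + t"] unfolding shift by simp
  then show ?thesis using km unfolding c rank_charpoly_eq by blast
qed

end

section \<open>The pencil of a square matrix\<close>

text \<open>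
  The matrix \<open>u(1 - F) + vF\<close>, written entrywise as \<open>u + (v - u)F\<close>.
\<close>

definition pencil :: "'p::comm_ring_1 mat \<Rightarrow> 'p poly \<Rightarrow> 'p poly \<Rightarrow> 'p poly mat" where
  "pencil F u v = mat (dim_row F) (dim_row F)
     (\<lambda>(i,j). (if i = j then u else 0) + smult (F $$ (i,j)) (v - u))"

text \<open>
  A product of linear forms is homogeneous; the coefficients \<open>w\<close> are independent of the point \<open>(u, v)\<close>,
  which is why they are chosen before \<open>u\<close> and \<open>v\<close>.
\<close>

lemma prod_linear_forms:
  fixes a b :: "'i \<Rightarrow> 'p::comm_ring_1"
  assumes "finite A"
  shows "\<exists>w. \<forall>u v. (\<Prod>i\<in>A. smult (a i) u + smult (b i) v) =
    (\<Sum>j\<le>card A. smult (w j) (u ^ (card A - j) * v ^ j))"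
  using assms
proof (induction A rule: finite_induct)
  case empty
  show ?case by (intro exI[of _ "\<lambda>_. 1"]) simp
next
  case (insert x A)
  then obtain w where w: "\<And>u v. (\<Prod>i\<in>A. smult (a i) u + smult (b i) v) =
    (\<Sum>j\<le>card A. smult (w j) (u ^ (card A - j) * v ^ j))" by blast
  define c where "c = card A"
  define w' where "w' j = a x * (if j \<le> c then w j else 0) + b x * (if j = 0 then 0 else w (j - 1))" for j
  have "(smult (a x) u + smult (b x) v) * (\<Sum>j\<le>c. smult (w j) (u ^ (c - j) * v ^ j)) =
    (\<Sum>j\<le>Suc c. smult (w' j) (u ^ (Suc c - j) * v ^ j))" for u v
  proof -
    have "(\<Sum>j\<le>Suc c. smult (w' j) (u ^ (Suc c - j) * v ^ j)) =
      (\<Sum>j\<le>Suc c. smult (a x * (if j \<le> c then w j else 0)) (u ^ (Suc c - j) * v ^ j)) +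
      (\<Sum>j\<le>Suc c. smult (b x * (if j = 0 then 0 else w (j - 1))) (u ^ (Suc c - j) * v ^ j))"
      by (simp only: w'_def smult_add_left sum.distrib)
    also have "(\<Sum>j\<le>Suc c. smult (a x * (if j \<le> c then w j else 0)) (u ^ (Suc c - j) * v ^ j)) =
      smult (a x) u * (\<Sum>j\<le>c. smult (w j) (u ^ (c - j) * v ^ j))"
      by (simp add: sum_distrib_left Suc_diff_le mult_ac)
    also have "(\<Sum>j\<le>Suc c. smult (b x * (if j = 0 then 0 else w (j - 1))) (u ^ (Suc c - j) * v ^ j)) =
      smult (b x) v * (\<Sum>j\<le>c. smult (w j) (u ^ (c - j) * v ^ j))"
      unfolding sum.atMost_Suc_shift by (simp add: sum_distrib_left mult_ac)
    finally show ?thesis by (simp add: distrib_right)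
  qed
  then show ?case
    using insert.hyps by (intro exI[of _ w']) (simp add: w flip: c_def)
qed

lemma det_pencil_expansion:
  fixes F :: "'p::comm_ring_1 mat"
  assumes "F \<in> carrier_mat n n"
  shows "\<exists>e. \<forall>u v. det (pencil F u v) = (\<Sum>j\<le>n. smult (e j) (u ^ (n - j) * v ^ j))"
proof -
  define a where "a p i = (if i = p i then 1 else 0) - F $$ (i, p i)" for p :: "nat \<Rightarrow> nat" and i
  have "\<exists>w. \<forall>u v. (\<Prod>i = 0..<n. smult (a p i) u + smult (F $$ (i, p i)) v) =
    (\<Sum>j\<le>n. smult (w j) (u ^ (n - j) * v ^ j))" for p
    using prod_linear_forms[of "{0..<n}" "a p" "\<lambda>i. F $$ (i, p i)"] by simp
  then obtain w where w: "\<And>p u v. (\<Prod>i = 0..<n. smult (a p i) u + smult (F $$ (i, p i)) v) =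
    (\<Sum>j\<le>n. smult (w p j) (u ^ (n - j) * v ^ j))" by metis
  define P where "P = {p. p permutes {0..<n}}"
  have "det (pencil F u v) = (\<Sum>j\<le>n. smult (\<Sum>p\<in>P. signof p * w p j) (u ^ (n - j) * v ^ j))" for u v
  proof -
    have C: "pencil F u v \<in> carrier_mat n n"
      using assms by (simp add: pencil_def)
    have "det (pencil F u v) =
        (\<Sum>p\<in>P. signof p * (\<Prod>i = 0..<n. smult (a p i) u + smult (F $$ (i, p i)) v))"
      unfolding det_def'[OF C] P_def
      using assms
      by (intro sum.cong refl arg_cong2[where f = "(*)"] prod.cong)
         (auto simp: pencil_def a_def smult_diff_left smult_diff_right)
    also have "\<dots> = (\<Sum>p\<in>P. \<Sum>j\<le>n. smult (signof p * w p j) (u ^ (n - j) * v ^ j))"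
      unfolding w by (intro sum.cong refl) (simp add: sign_def sum_negf)
    also have "\<dots> = (\<Sum>j\<le>n. smult (\<Sum>p\<in>P. signof p * w p j) (u ^ (n - j) * v ^ j))"
      by (subst sum.swap) (simp add: smult_sum)
    finally show ?thesis .
  qed
  then show ?thesis
    by (intro exI[of _ "\<lambda>j. \<Sum>p\<in>P. signof p * w p j"] allI)
qed

lemma pencil_charmat:
  "F \<in> carrier_mat n n \<Longrightarrow> pencil F [:0, 1:] ([:0, 1:] - 1) = [:0, 1:] \<cdot>\<^sub>m 1\<^sub>m n - map_mat (\<lambda>a. [:a:]) F"
  by (intro eq_matI) (auto simp: pencil_def)

lemma pencil_carrier [simp]: "F \<in> carrier_mat n n \<Longrightarrow> pencil F u v \<in> carrier_mat n n"
  by (simp add: pencil_def)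

text \<open>
  The pencil is multiplicative up to a multiple of \<open>FF - F\<close>, and the error is kept explicitly because a lift
  of an idempotent matrix need not be idempotent.
\<close>

lemma pencil_mult_index:
  fixes F :: "'p::comm_ring_1 mat"
  assumes F: "F \<in> carrier_mat n n" and ij: "i < n" "j < n"
  shows "(pencil F a b * pencil F c d) $$ (i, j) =
    pencil F (a * c) (b * d) $$ (i, j) + smult ((F * F) $$ (i,j) - F $$ (i,j)) ((b - a) * (d - c))"
proof -
  have "(pencil F a b * pencil F c d) $$ (i, j) = (\<Sum>l<n.
      ((if i = l then a else 0) + smult (F $$ (i,l)) (b - a)) *
      ((if l = j then c else 0) + smult (F $$ (l,j)) (d - c)))"
    using F ij by (simp add: pencil_def scalar_prod_def atLeast0LessThan)
  also have "\<dots> = (\<Sum>l<n. if i = l then a * (if l = j then c else 0) else 0) +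
      (\<Sum>l<n. if i = l then a * smult (F $$ (l,j)) (d - c) else 0) +
      (\<Sum>l<n. if l = j then smult (F $$ (i,l)) (b - a) * c else 0) +
      (\<Sum>l<n. smult (F $$ (i,l) * F $$ (l,j)) ((b - a) * (d - c)))"
    unfolding sum.distrib[symmetric]
    by (intro sum.cong refl) (auto simp: distrib_left distrib_right mult_ac)
  also have "\<dots> = (if i = j then a * c else 0) + smult (F $$ (i,j)) (a * (d - c)) +
      smult (F $$ (i,j)) ((b - a) * c) + smult ((F * F) $$ (i,j)) ((b - a) * (d - c))"
    using F ij by (simp add: scalar_prod_def atLeast0LessThan smult_sum)
  also have "\<dots> = pencil F (a * c) (b * d) $$ (i, j) +
      smult ((F * F) $$ (i,j) - F $$ (i,j)) ((b - a) * (d - c))"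
    using F ij
    by (simp add: pencil_def smult_diff_left smult_diff_right smult_add_right algebra_simps)
  finally show ?thesis .
qed

lemma pencil_same: "F \<in> carrier_mat n n \<Longrightarrow> pencil F u u = u \<cdot>\<^sub>m 1\<^sub>m n"
  by (intro eq_matI) (auto simp: pencil_def)

lemma pencil_poly_0:
  "F \<in> carrier_mat n n \<Longrightarrow> map_mat (\<lambda>p. poly p 0) (pencil F [:0, 1:] 1) = F"
  by (intro eq_matI) (auto simp: pencil_def)

definition pencil_coeff :: "'p::comm_ring_1 mat \<Rightarrow> nat \<Rightarrow> 'p" where
  "pencil_coeff F = (SOME e. \<forall>u v. det (pencil F u v) =
     (\<Sum>j\<le>dim_row F. smult (e j) (u ^ (dim_row F - j) * v ^ j)))"

lemma det_pencil:
  assumes "F \<in> carrier_mat n n"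
  shows "det (pencil F u v) = (\<Sum>j\<le>n. smult (pencil_coeff F j) (u ^ (n - j) * v ^ j))"
proof -
  have "\<exists>e. \<forall>u v. det (pencil F u v) =
     (\<Sum>j\<le>dim_row F. smult (e j) (u ^ (dim_row F - j) * v ^ j))"
    using det_pencil_expansion[OF assms] assms by simp
  from someI_ex[OF this, folded pencil_coeff_def] show ?thesis using assms by simp
qed

lemma sum_pencil_coeff:
  assumes "F \<in> carrier_mat n n"
  shows "(\<Sum>j\<le>n. pencil_coeff F j) = 1"
proof -
  have "(\<Sum>j\<le>n. smult (pencil_coeff F j) 1) = 1"
    using det_pencil[OF assms, of 1 1] pencil_same[OF assms, of 1] by simp
  then have "Polynomial.coeff (\<Sum>j\<le>n. smult (pencil_coeff F j) 1) 0 = 1" by simp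
  then show ?thesis by (simp add: coeff_sum)
qed

lemma mixed_radix_eq_iff:
  fixes i j k l s :: nat
  assumes "i < s" "k < s"
  shows "i + s * j = k + s * l \<longleftrightarrow> i = k \<and> j = l"
proof
  assume eq: "i + s * j = k + s * l"
  then have "(i + s * j) mod s = (k + s * l) mod s" "(i + s * j) div s = (k + s * l) div s" by simp_all
  then show "i = k \<and> j = l" using assms by auto
qed simp

lemma det_pencil_charpoly:
  "F \<in> carrier_mat n n \<Longrightarrow> det (pencil F [:0, 1:] ([:0, 1:] - 1)) =
    (\<Sum>j\<le>n. smult (pencil_coeff F j) (rank_poly j n))"
  by (simp add: det_pencil rank_poly_def)

section \<open>Idempotents attached to a projection matrix\<close>

text \<open>
  The matrix \<open>F\<close> is idempotent only after applying \<open>h\<close>.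
\<close>

locale idempotent_lift = cring_map R h for R (structure) and h :: "'p::comm_ring_1 \<Rightarrow> 'a" +
  fixes F :: "'p mat" and n :: nat
  assumes F [simp]: "F \<in> carrier_mat n n"
    and idem: "map_mat h (F * F) = map_mat h F"
begin

sublocale P: cring_map "UP R" H
  by (rule coefficientwise)

abbreviation e where "e \<equiv> pencil_coeff F"

lemma pencil_mult:
  "map_mat H (pencil F a b * pencil F c d) = map_mat H (pencil F (a * c) (b * d))"
proof (rule eq_matI)
  fix i j assume "i < dim_row (map_mat H (pencil F (a * c) (b * d)))"
    "j < dim_col (map_mat H (pencil F (a * c) (b * d)))"
  then have ij: "i < n" "j < n" using F by (simp_all add: pencil_def)
  have "h ((F * F) $$ (i,j)) = h (F $$ (i,j))"
    using arg_cong[OF idem, of "\<lambda>M. M $$ (i,j)"] ij F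
    by (simp del: index_mult_mat(1))
  then have "H (smult ((F * F) $$ (i,j) - F $$ (i,j)) p) = H 0" for p
    by (simp add: mult diff zero a_minus_def r_neg)
  then have "H ((pencil F a b * pencil F c d) $$ (i, j)) = H (pencil F (a * c) (b * d) $$ (i, j))"
    unfolding pencil_mult_index[OF F ij] by (simp only: P.add P.zero P.r_zero P.closed)
  then show "map_mat H (pencil F a b * pencil F c d) $$ (i, j) =
      map_mat H (pencil F (a * c) (b * d)) $$ (i, j)"
    using ij by (simp add: carrier_matD[OF pencil_carrier[OF F]] del: index_mult_mat(1))
qed (use F in \<open>auto simp: pencil_def\<close>)

lemma det_pencil_mult:
  "H (det (pencil F a b) * det (pencil F c d)) = H (det (pencil F (a * c) (b * d)))"
proof -
  have "H (det (pencil F a b * pencil F c d)) = H (det (pencil F (a * c) (b * d)))"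
    by (rule P.det_cong[where n = n]) (auto intro: pencil_mult mult_carrier_mat[where n = n])
  then show ?thesis by (simp add: det_mult[where n = n])
qed

text \<open>
  Multiplicativity compares $D(X) D(Y)$ with $D(XY)$ for $D(v) = \sum_j e_j v^j$.  A second variable is
  avoided by taking $Y = X^s$ with \<open>s > n\<close>: the exponents \<open>i + s k\<close> with \<open>i \<le> n\<close> are distinct, so the
  coefficient of $X^{i + sk}$ isolates $e_i e_k$ on one side and $e_i$ (if \<open>i = k\<close>) or \<open>0\<close> on the other.
\<close>

lemma orthogonal_idempotents:
  assumes i: "i \<le> n" and k: "k \<le> n"
  shows "h (e i * e k) = (if i = k then h (e i) else \<zero>)"
proof -
  \<comment> \<open>Large enough for the exponents \<open>i + s k\<close> to be read as two digits in base \<open>s\<close>.\<close>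
  define s where "s = Suc n"
  define t where "t = i + s * k"
  have X: "smult c (1 ^ a * Polynomial.monom 1 r ^ b) = Polynomial.monom c (r * b)" for c :: 'p and a b r
    by (simp add: monom_power smult_monom)
  have digits: "a + s * b = t \<longleftrightarrow> a = i \<and> b = k" if "a \<le> n" for a b
    unfolding t_def by (rule mixed_radix_eq_iff) (use i that in \<open>auto simp: s_def\<close>)
  have "Polynomial.coeff (det (pencil F 1 (Polynomial.monom 1 1)) *
      det (pencil F 1 (Polynomial.monom 1 s))) t =
      (\<Sum>a\<le>n. \<Sum>b\<le>n. if a + s * b = t then e a * e b else 0)"
    unfolding det_pencil[OF F] X sum_product mult_monom coeff_sum coeff_monom by simp
  also have "\<dots> = (\<Sum>a\<le>n. \<Sum>b\<le>n. if a = i then if b = k then e a * e b else 0 else 0)"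
    by (intro sum.cong refl) (simp add: digits)
  also have "\<dots> = (\<Sum>a\<le>n. if a = i then (\<Sum>b\<le>n. if b = k then e a * e b else 0) else 0)"
    by (intro sum.cong refl) simp
  also have "\<dots> = e i * e k"
    unfolding sum.delta[OF finite_atMost] using i k by simp
  finally have lhs: "Polynomial.coeff (det (pencil F 1 (Polynomial.monom 1 1)) *
      det (pencil F 1 (Polynomial.monom 1 s))) t = e i * e k" .
  have "Polynomial.coeff (det (pencil F (1 * 1) (Polynomial.monom 1 1 * Polynomial.monom 1 s))) t =
      (\<Sum>a\<le>n. if a + s * a = t then e a else 0)"
    unfolding det_pencil[OF F] mult_monom mult_1_left X coeff_sum coeff_monom by simp
  also have "\<dots> = (\<Sum>a\<le>n. if a = i then (if i = k then e i else 0) else 0)"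
    by (intro sum.cong refl) (auto simp: digits)
  also have "\<dots> = (if i = k then e i else 0)"
    unfolding sum.delta[OF finite_atMost] using i by simp
  finally show ?thesis
    using fun_cong[OF det_pencil_mult[of 1 "Polynomial.monom 1 1" 1 "Polynomial.monom 1 s"], of t]
    unfolding lhs by (simp add: zero)
qed

text \<open>
  Multiplication by $e_i$ turns the characteristic polynomial into $e_i X^{n-i}(X-1)^i$.  For \<open>i \<noteq> k\<close> its
  difference with $e_i X^{n-k}(X-1)^k$ has a coefficient that is $e_i$ times a unit, at the smaller of the
  two orders of vanishing, so nilpotency passes to $e_i$.
\<close>

lemma rank_determines_idempotents:
  assumes k: "k \<le> n" and j: "j \<le> n"
    and nil: "\<And>t. nilpotent R (h (Polynomial.coeff
      (det (pencil F [:0, 1:] ([:0, 1:] - 1)) - rank_poly k n) t))"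
  shows "h (e j) = (if j = k then \<one> else \<zero>)"
proof -
  have other: "h (e i) = \<zero>" if i: "i \<le> n" "i \<noteq> k" for i
  proof -
    define d :: "'p poly" where "d = rank_poly i n - rank_poly k n"
    obtain t and w :: 'p where t: "Polynomial.coeff d t = w" "w * w = 1"
    proof (cases "i < k")
      case True
      then have "n - k < n - i" using k by simp
      then have "Polynomial.coeff d (n - k) = - ((- 1) ^ k)"
        by (simp add: d_def coeff_rank_poly_below coeff_rank_poly_bottom)
      then show ?thesis by (intro that[OF refl, of "n - k"]) (simp flip: power_mult_distrib)
    next
      case False
      then have "n - i < n - k" using i by simp
      then have "Polynomial.coeff d (n - i) = (- 1) ^ i"
        by (simp add: d_def coeff_rank_poly_below coeff_rank_poly_bottom)
      then show ?thesis by (intro that[OF refl, of "n - i"]) (simp flip: power_mult_distrib)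
    qed
    define c where "c j = Polynomial.coeff (rank_poly j n :: 'p poly) t" for j
    have single: "h (e i * (e j * c j)) = (if i = j then h (e i * c j) else \<zero>)" if "j \<le> n" for j
    proof -
      have "h (e i * (e j * c j)) = h (e i * e j) \<otimes> h (c j)" by (simp add: mult m_assoc)
      then show ?thesis using orthogonal_idempotents[OF i(1) that] by (auto simp: mult)
    qed
    have "h (e i * Polynomial.coeff (det (pencil F [:0, 1:] ([:0, 1:] - 1))) t) =
        (\<Oplus>j\<in>{..n}. h (e i * (e j * c j)))"
      unfolding det_pencil_charpoly[OF F] by (simp add: coeff_sum sum_distrib_left sum c_def)
    also have "\<dots> = (\<Oplus>j\<in>{..n}. if i = j then h (e i * c j) else \<zero>)"
      by (intro finsum_cong') (auto simp: single)
    also have "\<dots> = h (e i * c i)"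
      using finsum_singleton[of i "{..n}" "\<lambda>j. h (e i * c j)"] i(1) by (simp add: Pi_def)
    finally have "h (e i * Polynomial.coeff (det (pencil F [:0, 1:] ([:0, 1:] - 1))) t) =
        h (e i * c i)" .
    then have "h (e i * Polynomial.coeff (det (pencil F [:0, 1:] ([:0, 1:] - 1)) - rank_poly k n) t) =
        h (e i * w)"
      by (simp add: d_def c_def right_diff_distrib diff flip: t(1))
    then have "nilpotent R (h (e i * w))"
      using nilpotent_mult[OF nil[of t], of "e i"] by (simp add: mult.commute)
    then have "nilpotent R (h (e i * w * w))" by (rule nilpotent_mult)
    then have "nilpotent R (h (e i))" using t(2) by (simp add: mult.assoc)
    then show ?thesis
      using orthogonal_idempotents[OF i(1) i(1)] by (intro idempotent_nilpotent) (auto simp: mult)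
  qed
  have "(\<Oplus>i\<in>{..n}. h (e i)) = \<one>"
    using sum_pencil_coeff[OF F] by (metis one sum finite_atMost)
  moreover have "(\<Oplus>i\<in>{..n}. h (e i)) = (\<Oplus>i\<in>{..n}. if k = i then h (e i) else \<zero>)"
    using other by (intro finsum_cong') auto
  ultimately have "h (e k) = \<one>"
    using finsum_singleton[of k "{..n}" "\<lambda>i. h (e i)"] k by (simp add: Pi_def)
  then show ?thesis using other j by simp
qed

lemma charpoly_eq_rank_poly:
  assumes k: "k \<le> n" and e: "\<And>j. j \<le> n \<Longrightarrow> h (e j) = (if j = k then \<one> else \<zero>)"
  shows "H (det (pencil F [:0, 1:] ([:0, 1:] - 1))) = H (rank_poly k n)"
proof
  fix t
  have "(\<Oplus>j\<in>{..n}. h (e j) \<otimes> h (Polynomial.coeff (rank_poly j n) t)) =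
      (\<Oplus>j\<in>{..n}. if k = j then h (Polynomial.coeff (rank_poly j n) t) else \<zero>)"
    using e by (intro finsum_cong') auto
  then show "H (det (pencil F [:0, 1:] ([:0, 1:] - 1))) t = H (rank_poly k n) t"
    unfolding det_pencil_charpoly[OF F]
    using finsum_singleton[of k "{..n}" "\<lambda>j. h (Polynomial.coeff (rank_poly j n) t)"] k
    by (simp add: coeff_sum sum mult Pi_def)
qed

end

section \<open>Vanishing of minors\<close>

lemma index_mult_mat_sum:
  assumes "A \<in> carrier_mat a b" "B \<in> carrier_mat b c" "i < a" "j < c"
  shows "(A * B) $$ (i, j) = (\<Sum>l<b. A $$ (i, l) * B $$ (l, j))"
  using assms by (simp add: scalar_prod_def atLeast0LessThan)

context idempotent_lift
begin

lemma det_pencil_1_X: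
  assumes k: "k \<le> n" and e: "\<And>j. j \<le> n \<Longrightarrow> h (e j) = (if j = k then \<one> else \<zero>)"
  shows "H (det (pencil F 1 [:0, 1:])) = H ([:0, 1:] ^ k)"
proof
  fix t
  have "Polynomial.coeff (det (pencil F 1 [:0, 1:])) t = (\<Sum>j\<le>n. if j = t then e j else 0)"
    by (simp add: det_pencil[OF F] X_power coeff_sum coeff_monom if_distrib[of "(*) _"] cong: if_cong)
  then show "H (det (pencil F 1 [:0, 1:])) t = H ([:0, 1:] ^ k) t"
    using e k by (auto simp: X_power zero one)
qed

text \<open>
  With \<open>A\<close> and \<open>B\<close> the pencils at \<open>(1, X)\<close> and \<open>(X, 1)\<close>, the product of the block matrices with rows
  \<open>(1, 0)\<close>, \<open>(-TB, X)\<close> and \<open>(A, -S)\<close>, \<open>(T, 0)\<close> has rows \<open>(A, -S)\<close>, \<open>(0, TBS)\<close> since \<open>BA = X\<close>.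
  Taking determinants, $X^r$ divides $X^k \det(TBS)$.
\<close>

lemma compression_det_zero:
  assumes k: "k \<le> n" and e: "\<And>j. j \<le> n \<Longrightarrow> h (e j) = (if j = k then \<one> else \<zero>)"
    and T: "T \<in> carrier_mat r n" and S: "S \<in> carrier_mat n r" and r: "k < r"
  shows "h (det (T * F * S)) = \<zero>"
proof -
  let ?C = "map_mat (\<lambda>x. [:x:])"
  define X :: "'p poly" where "X = [:0, 1:]"
  define A where "A = pencil F 1 X"
  define B where "B = pencil F X 1"
  define T' where "T' = ?C T"
  define S' where "S' = ?C S"
  have A: "A \<in> carrier_mat n n" and B: "B \<in> carrier_mat n n"
    and T': "T' \<in> carrier_mat r n" and S': "S' \<in> carrier_mat n r"
    using T S by (simp_all add: A_def B_def T'_def S'_def)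
  define N where "N = T' * B * S'"
  have TB: "T' * B \<in> carrier_mat r n" and N: "N \<in> carrier_mat r r"
    using T' B S' by (simp_all add: N_def)
  let ?M = "four_block_mat A (- S') T' (0\<^sub>m r r)"
  let ?U = "four_block_mat (1\<^sub>m n) (0\<^sub>m n r) (- (T' * B)) (X \<cdot>\<^sub>m 1\<^sub>m r)"
  have M: "?M \<in> carrier_mat (n + r) (n + r)" using A by (intro four_block_carrier_mat) auto
  have U: "?U \<in> carrier_mat (n + r) (n + r)" by (intro four_block_carrier_mat) auto
  define Z where "Z = - (T' * B * A) + X \<cdot>\<^sub>m T'"
  have Z: "Z \<in> carrier_mat r n" using T' TB A by (simp add: Z_def)
  have UM: "?U * ?M = four_block_mat A (- S') Z N"
  proof -
    have "?U * ?M = four_block_mat (1\<^sub>m n * A + 0\<^sub>m n r * T') (1\<^sub>m n * - S' + 0\<^sub>m n r * 0\<^sub>m r r)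
        (- (T' * B) * A + (X \<cdot>\<^sub>m 1\<^sub>m r) * T') (- (T' * B) * - S' + (X \<cdot>\<^sub>m 1\<^sub>m r) * 0\<^sub>m r r)"
      using A S' T' TB
      by (intro mult_four_block_mat[where ?nr1.0 = n and ?n1.0 = n and ?n2.0 = r and ?nr2.0 = r
            and ?nc1.0 = n and ?nc2.0 = r]) simp_all
    moreover have "1\<^sub>m n * A + 0\<^sub>m n r * T' = A" "1\<^sub>m n * - S' + 0\<^sub>m n r * 0\<^sub>m r r = - S'"
      using A S' T' by (simp_all add: left_mult_zero_mat[OF T'] left_mult_zero_mat[OF zero_carrier_mat]
          left_mult_one_mat[OF A] left_mult_one_mat[of "- S'" n r])
    moreover have "- (T' * B) * A + (X \<cdot>\<^sub>m 1\<^sub>m r) * T' = Z"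
      unfolding Z_def mult_smult_assoc_mat[OF one_carrier_mat T'] using T' TB A B by simp
    moreover have "- (T' * B) * - S' + (X \<cdot>\<^sub>m 1\<^sub>m r) * 0\<^sub>m r r = N"
      unfolding N_def using T' B TB S' by simp
    ultimately show ?thesis by (simp only:)
  qed
  have "map_mat H (T' * B * A) = map_mat H (X \<cdot>\<^sub>m T')"
  proof -
    have "map_mat H (T' * B * A) = mat_prod (UP R) (map_mat H T') (map_mat H (B * A))"
      using T' B A by (simp add: assoc_mult_mat[OF T' B A] P.mat_prod[where m = r and n = n and r = n])
    also have "map_mat H (B * A) = map_mat H (X \<cdot>\<^sub>m 1\<^sub>m n)"
      unfolding A_def B_def pencil_mult by (simp add: pencil_same[OF F])
    also have "mat_prod (UP R) (map_mat H T') \<dots> = map_mat H (T' * (X \<cdot>\<^sub>m 1\<^sub>m n))"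
      using T' by (simp add: P.mat_prod[where m = r and n = n and r = n])
    also have "T' * (X \<cdot>\<^sub>m 1\<^sub>m n) = X \<cdot>\<^sub>m T'"
      using T' by (simp add: mult_smult_distrib[OF T' one_carrier_mat])
    finally show ?thesis .
  qed
  then have Z0: "H (Z $$ (i, j)) = H 0" if "i < r" "j < n" for i j
  proof -
    have "H ((T' * B * A) $$ (i, j)) = H ((X \<cdot>\<^sub>m T') $$ (i, j))"
      using arg_cong[OF \<open>map_mat H (T' * B * A) = map_mat H (X \<cdot>\<^sub>m T')\<close>, of "\<lambda>M. M $$ (i,j)"]
        that T' TB A by (simp del: index_mult_mat(1) index_smult_mat(1))
    moreover have "Z $$ (i, j) = (X \<cdot>\<^sub>m T') $$ (i, j) - (T' * B * A) $$ (i, j)"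
      using that T' TB A by (simp add: Z_def del: index_mult_mat(1))
    ultimately show ?thesis by (simp only: P.diff P.zero) (simp add: P.r_neg a_minus_def)
  qed
  have "H (det (four_block_mat A (- S') Z N)) = H (det (four_block_mat A (- S') (0\<^sub>m r n) N))"
  proof (rule P.det_cong)
    show "four_block_mat A (- S') Z N \<in> carrier_mat (n + r) (n + r)"
      using A N by simp
    show "map_mat H (four_block_mat A (- S') Z N) = map_mat H (four_block_mat A (- S') (0\<^sub>m r n) N)"
      using A N Z S' by (intro eq_matI) (auto simp: Z0 simp del: coeff_0)
  qed
  also have "det (four_block_mat A (- S') (0\<^sub>m r n) N) = det A * det N"
    using A S' N by (intro det_four_block_lower_left_zero) auto
  also have "det (four_block_mat A (- S') Z N) = X ^ r * det ?M"
  proof -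
    have "det (?U * ?M) = det ?U * det ?M" by (rule det_mult[OF U M])
    also have "det ?U = X ^ r"
      using TB by (subst det_four_block_upper_right_zero) auto
    finally show ?thesis unfolding UM .
  qed
  finally have main: "H (X ^ r * det ?M) = H (X ^ k * det N)"
    using det_pencil_1_X[OF k e] unfolding A_def X_def by (simp only: P.mult)
  \<comment> \<open>The coefficient of degree \<open>k\<close>: below the order \<open>r\<close> on the left, the value at \<open>0\<close> on the right.\<close>
  have "h (Polynomial.coeff (X ^ k * det N) k) = h (Polynomial.coeff (X ^ r * det ?M) k)"
    using fun_cong[OF main] by simp
  also have "\<dots> = \<zero>"
    using r by (simp add: X_def X_power coeff_monom_mult zero)
  finally have "h (poly (det N) 0) = \<zero>"
    by (simp add: X_def X_power coeff_monom_mult poly_0_coeff_0)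
  moreover have "poly (det N) 0 = det (T * F * S)"
  proof -
    interpret ev: comm_ring_hom "\<lambda>p::'p poly. poly p 0" by unfold_locales auto
    have "map_mat (\<lambda>p. poly p 0) N = map_mat (\<lambda>p. poly p 0) T' * map_mat (\<lambda>p. poly p 0) B * map_mat (\<lambda>p. poly p 0) S'"
      unfolding N_def ev.mat_hom_mult[OF TB S'] ev.mat_hom_mult[OF T' B] ..
    also have "map_mat (\<lambda>p. poly p 0) T' = T" by (intro eq_matI) (auto simp: T'_def)
    also have "map_mat (\<lambda>p. poly p 0) S' = S" by (intro eq_matI) (auto simp: S'_def)
    also have "map_mat (\<lambda>p. poly p 0) B = F" unfolding B_def X_def by (rule pencil_poly_0[OF F])
    finally show ?thesis by (metis ev.hom_det)
  qed
  ultimately show ?thesis by simp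
qed

text \<open>
  A submatrix is \<open>TFS\<close> with selection matrices \<open>T\<close> and \<open>S\<close>.
\<close>

lemma minor_zero:
  assumes k: "k \<le> n" and e: "\<And>j. j \<le> n \<Longrightarrow> h (e j) = (if j = k then \<one> else \<zero>)"
    and I: "I \<subseteq> {..<n}" "card I = r" and J: "J \<subseteq> {..<n}" "card J = r" and r: "k < r"
  shows "mat_det R (submatrix (map_mat h F) I J) = \<zero>"
proof -
  define T where "T = mat r n (\<lambda>(i,l). if l = pick I i then 1 else 0 :: 'p)"
  define S where "S = mat n r (\<lambda>(l,j). if l = pick J j then 1 else 0 :: 'p)"
  have T: "T \<in> carrier_mat r n" and S: "S \<in> carrier_mat n r" by (simp_all add: T_def S_def)
  have cI: "card {i. i < n \<and> i \<in> I} = r" and cJ: "card {i. i < n \<and> i \<in> J} = r"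
  proof -
    have "{i. i < n \<and> i \<in> I} = I" "{i. i < n \<and> i \<in> J} = J" using I(1) J(1) by auto
    then show "card {i. i < n \<and> i \<in> I} = r" "card {i. i < n \<and> i \<in> J} = r"
      using I(2) J(2) by simp_all
  qed
  have pI: "pick I i < n" and pJ: "pick J i < n" if "i < r" for i
    using that pick_in_set_le[of i I] pick_in_set_le[of i J] I J by auto
  have TFS: "(T * F * S) $$ (i, j) = F $$ (pick I i, pick J j)" if "i < r" "j < r" for i j
  proof -
    have "(T * F) $$ (i, l) = F $$ (pick I i, l)" if "l < n" for l
      unfolding index_mult_mat_sum[OF T F \<open>i < r\<close> that]
      using \<open>i < r\<close> that pI by (simp add: T_def if_distrib[of "\<lambda>x. x * _"] cong: if_cong)
    then show ?thesis
      unfolding index_mult_mat_sum[OF mult_carrier_mat[OF T F] S that]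
      using that pJ by (simp add: S_def if_distrib[of "(*) _"] cong: if_cong del: index_mult_mat(1))
  qed
  have TFSc: "T * F * S \<in> carrier_mat r r" using T S F by (simp add: mult_carrier_mat[where n = n])
  have "submatrix (map_mat h F) I J = map_mat h (T * F * S)"
    using carrier_matD[OF F] carrier_matD[OF TFSc]
    by (intro eq_matI) (simp_all add: submatrix_def cI cJ TFS pI pJ del: index_mult_mat(1))
  then show ?thesis
    using compression_det_zero[OF k e T S r] det[OF TFSc] by simp
qed

end

section \<open>Images of projection matrices\<close>

context cring begin

lemma free_mod_carrier_iff [simp]:
  "v \<in> carrier (free_mod R n) \<longleftrightarrow> dim_vec v = n \<and> (\<forall>i<n. v $ i \<in> carrier R)"
  by (auto simp: free_mod_def)

lemma free_mod_simps [simp]: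
  "v \<oplus>\<^bsub>free_mod R n\<^esub> w = vec n (\<lambda>i. v $ i \<oplus> w $ i)"
  "\<zero>\<^bsub>free_mod R n\<^esub> = vec n (\<lambda>i. \<zero>)"
  "a \<odot>\<^bsub>free_mod R n\<^esub> v = vec n (\<lambda>i. a \<otimes> v $ i)"
  by (simp_all add: free_mod_def)

lemma free_mod_module: "module R (free_mod R n)"
proof (rule moduleI)
  show "abelian_group (free_mod R n)"
  proof (rule abelian_groupI)
    fix x assume "x \<in> carrier (free_mod R n)"
    then show "\<exists>y\<in>carrier (free_mod R n). y \<oplus>\<^bsub>free_mod R n\<^esub> x = \<zero>\<^bsub>free_mod R n\<^esub>"
      by (intro bexI[of _ "vec n (\<lambda>i. \<ominus> (x $ i))"]) (auto simp: l_neg)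
  qed (auto simp: a_assoc a_comm a_lcomm intro!: eq_vecI)
qed (auto simp: is_cring l_distr r_distr m_assoc intro!: eq_vecI)

lemma matricesD:
  "A \<in> matrices R m n \<Longrightarrow> A \<in> carrier_mat m n"
  "A \<in> matrices R m n \<Longrightarrow> i < m \<Longrightarrow> j < n \<Longrightarrow> A $$ (i,j) \<in> carrier R"
  by (auto simp: matrices_def)

lemma mat_app_closed:
  assumes "A \<in> matrices R m n" "v \<in> carrier (free_mod R n)"
  shows "mat_app R A v \<in> carrier (free_mod R m)"
  using assms matricesD[OF assms(1)] by (auto simp: mat_app_def intro!: finsum_closed)

abbreviation unit_tuple :: "nat \<Rightarrow> nat \<Rightarrow> 'a vec" where
  "unit_tuple n j \<equiv> vec n (\<lambda>i. if i = j then \<one> else \<zero>)"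

lemma mat_app_unit:
  assumes "A \<in> matrices R m n" "i < m" "j < n"
  shows "mat_app R A (unit_tuple n j) $ i = A $$ (i, j)"
proof -
  have "mat_app R A (unit_tuple n j) $ i = (\<Oplus>l\<in>{..<n}. if j = l then A $$ (i, l) else \<zero>)"
    using assms matricesD[OF assms(1)] by (auto simp: mat_app_def intro!: finsum_cong')
  also have "\<dots> = A $$ (i, j)"
    using assms matricesD[OF assms(1)] by (intro finsum_singleton) auto
  finally show ?thesis .
qed

lemma matrix_eqI:
  assumes A: "A \<in> matrices R m n" and B: "B \<in> matrices R m n"
    and eq: "\<And>v. v \<in> carrier (free_mod R n) \<Longrightarrow> mat_app R A v = mat_app R B v"
  shows "A = B"
proof (rule eq_matI)
  fix i j assume "i < dim_row B" "j < dim_col B"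
  then have "i < m" "j < n" using matricesD(1)[OF B] by auto
  moreover have "mat_app R A (unit_tuple n j) = mat_app R B (unit_tuple n j)"
    by (rule eq) simp
  ultimately show "A $$ (i, j) = B $$ (i, j)"
    using mat_app_unit[OF A, of i j] mat_app_unit[OF B, of i j] by simp
qed (use matricesD(1)[OF A] matricesD(1)[OF B] in auto)

text \<open>
  The image of \<open>v\<close> is accumulated one coordinate at a time, on the truncations of \<open>v\<close> to its first
  \<open>k\<close> coordinates.
\<close>

lemma mod_hom_free_matrix:
  assumes f: "f \<in> mod_hom R (free_mod R m) (free_mod R n)"
  shows "\<exists>Q\<in>matrices R n m. \<forall>v\<in>carrier (free_mod R m). f v = mat_app R Q v"
proof -
  have closed: "f v \<in> carrier (free_mod R n)" if "v \<in> carrier (free_mod R m)" for v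
    using f that unfolding mod_hom_def by blast
  have dim: "dim_vec (f v) = n" and entry: "i < n \<Longrightarrow> f v $ i \<in> carrier R"
    if "v \<in> carrier (free_mod R m)" for v i
    using closed[OF that] by auto
  have add: "f (v \<oplus>\<^bsub>free_mod R m\<^esub> w) = f v \<oplus>\<^bsub>free_mod R n\<^esub> f w"
    if "v \<in> carrier (free_mod R m)" "w \<in> carrier (free_mod R m)" for v w
    using f that unfolding mod_hom_def by blast
  have smult: "f (a \<odot>\<^bsub>free_mod R m\<^esub> v) = a \<odot>\<^bsub>free_mod R n\<^esub> f v"
    if "a \<in> carrier R" "v \<in> carrier (free_mod R m)" for a v
    using f that unfolding mod_hom_def by blast
  define Q where "Q = mat n m (\<lambda>(i,j). f (unit_tuple m j) $ i)"
  have unit: "unit_tuple m j \<in> carrier (free_mod R m)" for j by simp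
  have Q: "Q \<in> matrices R n m"
    using entry[OF unit] by (auto simp: matrices_def Q_def)
  have "f v = mat_app R Q v" if v: "v \<in> carrier (free_mod R m)" for v
  proof -
    define trunc where "trunc k = vec m (\<lambda>i. if i < k then v $ i else \<zero>)" for k
    have trunc: "trunc k \<in> carrier (free_mod R m)" for k
      using v by (simp add: trunc_def)
    have "f (trunc k) = vec n (\<lambda>i. \<Oplus>l\<in>{..<k}. Q $$ (i,l) \<otimes> v $ l)" if "k \<le> m" for k
      using that
    proof (induction k)
      case 0
      have "trunc 0 = \<zero> \<odot>\<^bsub>free_mod R m\<^esub> v" using v by (auto simp: trunc_def)
      then have "f (trunc 0) = \<zero> \<odot>\<^bsub>free_mod R n\<^esub> f v" using smult[OF zero_closed v] by simp
      then show ?case using entry[OF v] by auto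
    next
      case (Suc k)
      then have k: "k < m" by simp
      have vk: "v $ k \<in> carrier R" using v k by simp
      have "trunc (Suc k) = trunc k \<oplus>\<^bsub>free_mod R m\<^esub> (v $ k \<odot>\<^bsub>free_mod R m\<^esub> unit_tuple m k)"
        using v vk by (intro eq_vecI) (auto simp: trunc_def less_Suc_eq)
      then have "f (trunc (Suc k)) =
          f (trunc k) \<oplus>\<^bsub>free_mod R n\<^esub> (v $ k \<odot>\<^bsub>free_mod R n\<^esub> f (unit_tuple m k))"
        using add[OF trunc[of k], of "v $ k \<odot>\<^bsub>free_mod R m\<^esub> unit_tuple m k"]
          smult[OF vk unit] vk by simp
      moreover have "(\<Oplus>l\<in>{..<k}. Q $$ (i,l) \<otimes> v $ l) \<oplus> v $ k \<otimes> f (unit_tuple m k) $ i =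
          (\<Oplus>l\<in>{..<Suc k}. Q $$ (i,l) \<otimes> v $ l)" if i: "i < n" for i
      proof -
        have "(\<Oplus>l\<in>{..<Suc k}. Q $$ (i,l) \<otimes> v $ l) =
            Q $$ (i,k) \<otimes> v $ k \<oplus> (\<Oplus>l\<in>{..<k}. Q $$ (i,l) \<otimes> v $ l)"
          unfolding lessThan_Suc
          using matricesD(2)[OF Q i] v k by (intro finsum_insert) auto
        moreover have "(\<Oplus>l\<in>{..<k}. Q $$ (i,l) \<otimes> v $ l) \<in> carrier R"
          using matricesD(2)[OF Q i] v k by (intro finsum_closed) auto
        ultimately show ?thesis
          using i k vk entry[OF unit i] by (simp add: Q_def m_comm a_comm)
      qed
      ultimately show ?case using Suc.IH k by auto
    qed
    from this[of m] have "f (trunc m) = mat_app R Q v"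
      using matricesD(1)[OF Q] by (simp add: mat_app_def)
    moreover have "trunc m = v" using v by (auto simp: trunc_def)
    ultimately show ?thesis by simp
  qed
  then show ?thesis using Q by blast
qed

end

locale presentation = cring_map R h for R (structure) and h :: "'p::comm_ring_1 \<Rightarrow> 'a" +
  assumes range: "range h = carrier R"
begin

lemma h_inv: "a \<in> carrier R \<Longrightarrow> h (inv_into UNIV h a) = a"
  using f_inv_into_f[of a h UNIV] range by simp

lemma lift_mat:
  assumes "A \<in> matrices R m n" obtains A' where "A' \<in> carrier_mat m n" "map_mat h A' = A"
proof
  show "map_mat (inv_into UNIV h) A \<in> carrier_mat m n" using matricesD(1)[OF assms] by simp
  show "map_mat h (map_mat (inv_into UNIV h) A) = A"
    using matricesD[OF assms] by (intro eq_matI) (auto simp: h_inv)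
qed

lemma lift_vec:
  assumes "v \<in> carrier (free_mod R n)" obtains v' where "v' \<in> carrier_vec n" "map_vec h v' = v"
proof
  show "map_vec (inv_into UNIV h) v \<in> carrier_vec n"
    by (rule carrier_vecI) (use assms in simp)
  show "map_vec h (map_vec (inv_into UNIV h) v) = v"
    using assms by (intro eq_vecI) (simp_all add: h_inv)
qed

lemma map_mat_matrices: "A \<in> carrier_mat m n \<Longrightarrow> map_mat h A \<in> matrices R m n"
  by (auto simp: matrices_def)

lemma mat_prod_closed:
  assumes "A \<in> matrices R l m" "B \<in> matrices R m n"
  shows "mat_prod R A B \<in> matrices R l n"
proof -
  obtain A' where A: "A' \<in> carrier_mat l m" "map_mat h A' = A" using lift_mat[OF assms(1)] .
  obtain B' where B: "B' \<in> carrier_mat m n" "map_mat h B' = B" using lift_mat[OF assms(2)] .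
  have "mat_prod R A B = map_mat h (A' * B')" using A B mat_prod[OF A(1) B(1)] by simp
  also have "\<dots> \<in> matrices R l n" using A B by (intro map_mat_matrices) simp
  finally show ?thesis .
qed

lemma mat_app_mat_prod:
  assumes "A \<in> matrices R l m" "B \<in> matrices R m n" "v \<in> carrier (free_mod R n)"
  shows "mat_app R (mat_prod R A B) v = mat_app R A (mat_app R B v)"
proof -
  obtain A' where A: "A' \<in> carrier_mat l m" "map_mat h A' = A" using lift_mat[OF assms(1)] .
  obtain B' where B: "B' \<in> carrier_mat m n" "map_mat h B' = B" using lift_mat[OF assms(2)] .
  obtain v' where v: "v' \<in> carrier_vec n" "map_vec h v' = v" using lift_vec[OF assms(3)] .
  have "mat_app R (mat_prod R A B) v = map_vec h ((A' * B') *\<^sub>v v')"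
    unfolding mat_app[OF mult_carrier_mat[OF A(1) B(1)] v(1)] mat_prod[OF A(1) B(1)] A(2) B(2) v(2) ..
  also have "(A' * B') *\<^sub>v v' = A' *\<^sub>v (B' *\<^sub>v v')"
    using A B v by (intro assoc_mult_mat_vec)
  also have "map_vec h \<dots> = mat_app R A (mat_app R B v)"
    unfolding mat_app[OF A(1) mult_mat_vec_carrier[OF B(1) v(1)]] mat_app[OF B(1) v(1)] A(2) B(2) v(2) ..
  finally show ?thesis .
qed

lemma mat_app_linear:
  assumes "A \<in> matrices R m n"
  shows "mat_app R A \<in> mod_hom R (free_mod R n) (free_mod R m)"
  unfolding mod_hom_def
proof (intro CollectI conjI ballI)
  obtain A' where A: "A' \<in> carrier_mat m n" "map_mat h A' = A" using lift_mat[OF assms] .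
  show "mat_app R A \<in> carrier (free_mod R n) \<rightarrow> carrier (free_mod R m)"
    using mat_app_closed[OF assms] by blast
  fix v assume "v \<in> carrier (free_mod R n)"
  then obtain v' where v: "v' \<in> carrier_vec n" "map_vec h v' = v" by (rule lift_vec)
  show "mat_app R A (v \<oplus>\<^bsub>free_mod R n\<^esub> w) = mat_app R A v \<oplus>\<^bsub>free_mod R m\<^esub> mat_app R A w"
    if wc: "w \<in> carrier (free_mod R n)" for w
  proof -
    obtain w' where w: "w' \<in> carrier_vec n" "map_vec h w' = w" using lift_vec[OF wc] .
    have "v \<oplus>\<^bsub>free_mod R n\<^esub> w = map_vec h (v' + w')"
      using v w by (auto simp: add)
    then have "mat_app R A (v \<oplus>\<^bsub>free_mod R n\<^esub> w) = map_vec h (A' *\<^sub>v (v' + w'))"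
      using A v w by (simp add: mat_app[OF A(1)])
    also have "\<dots> = map_vec h (A' *\<^sub>v v' + A' *\<^sub>v w')"
      using A v w by (simp add: mult_add_distrib_mat_vec)
    also have "\<dots> = map_vec h (A' *\<^sub>v v') \<oplus>\<^bsub>free_mod R m\<^esub> map_vec h (A' *\<^sub>v w')"
      using A by (auto simp: add simp del: index_mult_mat_vec)
    finally show ?thesis using A v w by (simp add: mat_app[OF A(1)])
  qed
  show "mat_app R A (a \<odot>\<^bsub>free_mod R n\<^esub> v) = a \<odot>\<^bsub>free_mod R m\<^esub> mat_app R A v"
    if "a \<in> carrier R" for a
  proof -
    obtain b where b: "h b = a" using h_inv[OF \<open>a \<in> carrier R\<close>] by blast
    have "a \<odot>\<^bsub>free_mod R n\<^esub> v = map_vec h (b \<cdot>\<^sub>v v')"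
      using v b by (auto simp: mult)
    then have "mat_app R A (a \<odot>\<^bsub>free_mod R n\<^esub> v) = map_vec h (A' *\<^sub>v (b \<cdot>\<^sub>v v'))"
      using A v by (simp add: mat_app[OF A(1)])
    also have "\<dots> = map_vec h (b \<cdot>\<^sub>v (A' *\<^sub>v v'))"
      using A v by (intro arg_cong[where f = "map_vec h"] eq_vecI) simp_all
    also have "\<dots> = a \<odot>\<^bsub>free_mod R m\<^esub> map_vec h (A' *\<^sub>v v')"
      using A b by (auto simp: mult simp del: index_mult_mat_vec)
    finally show ?thesis using A v by (simp add: mat_app[OF A(1)])
  qed
qed

lemma image_mod_simps:
  assumes "A \<in> matrices R m n"
  shows "carrier (image_mod R A) = mat_app R A ` carrier (free_mod R n)"
    "ring.add (image_mod R A) = ring.add (free_mod R m)"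
    "Module.module.smult (image_mod R A) = Module.module.smult (free_mod R m)"
  using matricesD(1)[OF assms] by (simp_all add: image_mod_def)

lemma image_mod_module:
  assumes A: "A \<in> matrices R m n"
  shows "module R (image_mod R A)"
proof -
  interpret M: module R "free_mod R m" by (rule free_mod_module)
  interpret N: module R "free_mod R n" by (rule free_mod_module)
  have lin_add: "mat_app R A (x \<oplus>\<^bsub>free_mod R n\<^esub> y) = mat_app R A x \<oplus>\<^bsub>free_mod R m\<^esub> mat_app R A y"
    if "x \<in> carrier (free_mod R n)" "y \<in> carrier (free_mod R n)" for x y
    using mat_app_linear[OF A] that unfolding mod_hom_def by blast
  have lin_smult: "mat_app R A (a \<odot>\<^bsub>free_mod R n\<^esub> x) = a \<odot>\<^bsub>free_mod R m\<^esub> mat_app R A x"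
    if "a \<in> carrier R" "x \<in> carrier (free_mod R n)" for a x
    using mat_app_linear[OF A] that unfolding mod_hom_def by blast
  have "submodule (mat_app R A ` carrier (free_mod R n)) R (free_mod R m)"
  proof (rule M.submoduleI)
    have "mat_app R A (\<zero> \<odot>\<^bsub>free_mod R n\<^esub> \<zero>\<^bsub>free_mod R n\<^esub>) =
        \<zero> \<odot>\<^bsub>free_mod R m\<^esub> mat_app R A \<zero>\<^bsub>free_mod R n\<^esub>"
      by (rule lin_smult[OF zero_closed N.zero_closed])
    then have "mat_app R A \<zero>\<^bsub>free_mod R n\<^esub> = \<zero>\<^bsub>free_mod R m\<^esub>"
      unfolding M.smult_l_null[OF mat_app_closed[OF A N.zero_closed]] N.smult_l_null[OF N.zero_closed] .
    then show "\<zero>\<^bsub>free_mod R m\<^esub> \<in> mat_app R A ` carrier (free_mod R n)"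
      using N.zero_closed by (metis imageI)
    show smult: "a \<odot>\<^bsub>free_mod R m\<^esub> x \<in> mat_app R A ` carrier (free_mod R n)"
      if a: "a \<in> carrier R" and x: "x \<in> mat_app R A ` carrier (free_mod R n)" for a x
    proof -
      obtain v where v: "v \<in> carrier (free_mod R n)" "x = mat_app R A v" using x by (rule imageE)
      show ?thesis
        unfolding v(2) lin_smult[OF a v(1), symmetric] by (rule imageI) (rule N.smult_closed[OF a v(1)])
    qed
    show "\<ominus>\<^bsub>free_mod R m\<^esub> x \<in> mat_app R A ` carrier (free_mod R n)"
      if x: "x \<in> mat_app R A ` carrier (free_mod R n)" for x
    proof -
      have "x \<in> carrier (free_mod R m)" using x mat_app_closed[OF A] by blast
      then have "\<ominus>\<^bsub>free_mod R m\<^esub> x = \<ominus> \<one> \<odot>\<^bsub>free_mod R m\<^esub> x"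
        using M.smult_l_minus[of \<one> x] M.smult_one[of x] by simp
      then show ?thesis using smult[OF _ x, of "\<ominus> \<one>"] by simp
    qed
    show "x \<oplus>\<^bsub>free_mod R m\<^esub> y \<in> mat_app R A ` carrier (free_mod R n)"
      if x: "x \<in> mat_app R A ` carrier (free_mod R n)" and y: "y \<in> mat_app R A ` carrier (free_mod R n)" for x y
    proof -
      obtain v where v: "v \<in> carrier (free_mod R n)" "x = mat_app R A v" using x by (rule imageE)
      obtain w where w: "w \<in> carrier (free_mod R n)" "y = mat_app R A w" using y by (rule imageE)
      show ?thesis
        unfolding v(2) w(2) lin_add[OF v(1) w(1), symmetric] by (rule imageI) (rule N.a_closed[OF v(1) w(1)])
    qed
  qed (use mat_app_closed[OF A] in blast)
  from submodule.submodule_is_module[OF this free_mod_module] show ?thesis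
    using matricesD(1)[OF A] by (simp add: image_mod_def)
qed

lemma projection_fixes_image:
  assumes F: "F \<in> projections R n" and w: "w \<in> carrier (image_mod R F)"
  shows "w \<in> carrier (free_mod R n)" "mat_app R F w = w"
proof -
  have M: "F \<in> matrices R n n" and FF: "mat_prod R F F = F" using F by (auto simp: projections_def)
  obtain v where v: "v \<in> carrier (free_mod R n)" "w = mat_app R F v"
    using w unfolding image_mod_simps[OF M] by blast
  show "w \<in> carrier (free_mod R n)" using mat_app_closed[OF M v(1)] v(2) by simp
  show "mat_app R F w = w" using mat_app_mat_prod[OF M M v(1)] FF v(2) by simp
qed

lemma image_fg_projective:
  assumes F: "F \<in> projections R n"
  shows "fg_projective R (image_mod R F)"
proof -
  have M: "F \<in> matrices R n n" using F by (simp add: projections_def)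
  have incl: "(\<lambda>x. x) \<in> mod_hom R (image_mod R F) (free_mod R n)"
    using projection_fixes_image(1)[OF F] unfolding mod_hom_def image_mod_simps(2,3)[OF M] by blast
  have proj: "mat_app R F \<in> mod_hom R (free_mod R n) (image_mod R F)"
    using mat_app_linear[OF M] unfolding mod_hom_def image_mod_simps[OF M] by blast
  show ?thesis
    unfolding fg_projective_def
    by (intro conjI exI[of _ n] bexI[OF _ incl] bexI[OF _ proj] ballI image_mod_module[OF M]
        projection_fixes_image(2)[OF F])
qed

text \<open>
  \<open>Q\<close> is the matrix of the isomorphism \<open>f\<close> precomposed with the projection \<open>G\<close>, and \<open>P\<close> the matrix of its
  inverse precomposed with \<open>F\<close>; both compositions collapse because a projection fixes its image.
\<close>

lemma isomorphic_images_factor: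
  assumes G: "G \<in> projections R m" and F: "F \<in> projections R n"
    and iso: "mod_isomorphic R (image_mod R G) (image_mod R F)"
  obtains P Q where "P \<in> matrices R m n" "Q \<in> matrices R n m" "mat_prod R P Q = G" "mat_prod R Q P = F"
proof -
  have MG: "G \<in> matrices R m m" and MF: "F \<in> matrices R n n"
    using F G by (auto simp: projections_def)
  let ?IG = "carrier (image_mod R G)" and ?IF = "carrier (image_mod R F)"
  obtain f where f: "f \<in> mod_hom R (image_mod R G) (image_mod R F)" and bij: "bij_betw f ?IG ?IF"
    using iso unfolding mod_isomorphic_def by blast
  define g where "g = inv_into ?IG f"
  have g_in: "g y \<in> ?IG" and fg: "f (g y) = y" if "y \<in> ?IF" for y
    using bij that unfolding g_def bij_betw_def by (metis inv_into_into, metis f_inv_into_f)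
  have gf: "g (f x) = x" if "x \<in> ?IG" for x
    using bij that unfolding g_def bij_betw_def by (metis inv_into_f_f)
  have f_in: "f x \<in> ?IF" if "x \<in> ?IG" for x using f that by (auto simp: mod_hom_def)
  have f_add: "f (x \<oplus>\<^bsub>image_mod R G\<^esub> y) = f x \<oplus>\<^bsub>image_mod R F\<^esub> f y" if "x \<in> ?IG" "y \<in> ?IG" for x y
    using f that unfolding mod_hom_def by blast
  have f_smult: "f (a \<odot>\<^bsub>image_mod R G\<^esub> x) = a \<odot>\<^bsub>image_mod R F\<^esub> f x" if "a \<in> carrier R" "x \<in> ?IG" for a x
    using f that unfolding mod_hom_def by blast
  interpret IG: module R "image_mod R G" by (rule image_mod_module[OF MG])
  interpret IF: module R "image_mod R F" by (rule image_mod_module[OF MF])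
  have g: "g \<in> mod_hom R (image_mod R F) (image_mod R G)"
    unfolding mod_hom_def
  proof (intro CollectI conjI ballI)
    fix x assume x: "x \<in> ?IF"
    show "g (x \<oplus>\<^bsub>image_mod R F\<^esub> y) = g x \<oplus>\<^bsub>image_mod R G\<^esub> g y" if y: "y \<in> ?IF" for y
    proof -
      have "f (g x \<oplus>\<^bsub>image_mod R G\<^esub> g y) = x \<oplus>\<^bsub>image_mod R F\<^esub> y"
        unfolding f_add[OF g_in[OF x] g_in[OF y]] fg[OF x] fg[OF y] ..
      then show ?thesis using gf[OF IG.a_closed[OF g_in[OF x] g_in[OF y]]] by (simp only:)
    qed
    show "g (a \<odot>\<^bsub>image_mod R F\<^esub> x) = a \<odot>\<^bsub>image_mod R G\<^esub> g x" if a: "a \<in> carrier R" for a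
    proof -
      have "f (a \<odot>\<^bsub>image_mod R G\<^esub> g x) = a \<odot>\<^bsub>image_mod R F\<^esub> x"
        unfolding f_smult[OF a g_in[OF x]] fg[OF x] ..
      then show ?thesis using gf[OF IG.smult_closed[OF a g_in[OF x]]] by (simp only:)
    qed
  qed (use g_in in blast)
  have comp: "(\<lambda>v. u (mat_app R A v)) \<in> mod_hom R (free_mod R a) (free_mod R b)"
    if A: "A \<in> projections R a" and B: "B \<in> projections R b"
      and u: "u \<in> mod_hom R (image_mod R A) (image_mod R B)" for A B u a b
  proof -
    have MA: "A \<in> matrices R a a" and MB: "B \<in> matrices R b b"
      using A B by (auto simp: projections_def)
    have "mat_app R A v \<in> carrier (image_mod R A)" if "v \<in> carrier (free_mod R a)" for v
      using that unfolding image_mod_simps[OF MA] by blast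
    moreover have "w \<in> carrier (free_mod R b)" if "w \<in> carrier (image_mod R B)" for w
      using projection_fixes_image(1)[OF B that] .
    ultimately show ?thesis
      using u mat_app_linear[OF MA]
      unfolding mod_hom_def image_mod_simps(2,3)[OF MA] image_mod_simps(2,3)[OF MB]
      by (auto simp del: free_mod_carrier_iff free_mod_simps)
  qed
  obtain Q where Q: "Q \<in> matrices R n m"
    and Qf: "\<And>v. v \<in> carrier (free_mod R m) \<Longrightarrow> f (mat_app R G v) = mat_app R Q v"
    using mod_hom_free_matrix[OF comp[OF G F f]] by blast
  obtain P where P: "P \<in> matrices R m n"
    and Pg: "\<And>w. w \<in> carrier (free_mod R n) \<Longrightarrow> g (mat_app R F w) = mat_app R P w"
    using mod_hom_free_matrix[OF comp[OF F G g]] by blast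
  have "mat_prod R P Q = G"
  proof (rule matrix_eqI[OF mat_prod_closed[OF P Q] MG])
    fix v assume v: "v \<in> carrier (free_mod R m)"
    then have Gv: "mat_app R G v \<in> ?IG" unfolding image_mod_simps[OF MG] by blast
    have "mat_app R P (mat_app R Q v) = g (mat_app R F (f (mat_app R G v)))"
      using Pg[OF mat_app_closed[OF Q v]] Qf[OF v] by simp
    also have "\<dots> = mat_app R G v"
      using projection_fixes_image(2)[OF F f_in[OF Gv]] gf[OF Gv] by simp
    finally show "mat_app R (mat_prod R P Q) v = mat_app R G v"
      using mat_app_mat_prod[OF P Q v] by simp
  qed
  moreover have "mat_prod R Q P = F"
  proof (rule matrix_eqI[OF mat_prod_closed[OF Q P] MF])
    fix w assume w: "w \<in> carrier (free_mod R n)"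
    then have Fw: "mat_app R F w \<in> ?IF" unfolding image_mod_simps[OF MF] by blast
    have "mat_app R Q (mat_app R P w) = f (mat_app R G (g (mat_app R F w)))"
      using Qf[OF mat_app_closed[OF P w]] Pg[OF w] by simp
    also have "\<dots> = mat_app R F w"
      using projection_fixes_image(2)[OF G g_in[OF Fw]] fg[OF Fw] by simp
    finally show "mat_app R (mat_prod R Q P) w = mat_app R F w"
      using mat_app_mat_prod[OF Q P w] by simp
  qed
  ultimately show thesis using that P Q by blast
qed

end

section \<open>Rank and characteristic polynomial\<close>

theorem mainTheorem3:
  fixes R :: "('a, 'r) ring_scheme" and F :: "'a mat" and n k :: nat
  assumes "cring R"
    and "F \<in> matrices R n n"
    and "mat_prod R F F = F"
    and "k \<le> n"
  shows "(constant_rank R (image_mod R F) k \<longleftrightarrow> charpoly R F = rank_charpoly R k n) \<and>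
    (constant_rank R (image_mod R F) k \<longrightarrow>
      (\<forall>I J. I \<subseteq> {..<n} \<and> J \<subseteq> {..<n} \<and> card I = k + 1 \<and> card J = k + 1 \<longrightarrow>
        mat_det R (submatrix F I J) = \<zero>\<^bsub>R\<^esub>))"
proof -
  interpret cring R by fact
  obtain h :: "('a multiset \<Rightarrow>\<^sub>0 int) \<Rightarrow> 'a" where h: "cring_map R h" "range h = carrier R"
    using ex_presentation by blast
  interpret presentation R h
    using h by (simp add: presentation_def presentation_axioms_def)
  have proj: "F \<in> projections R n" using assms(2,3) by (simp add: projections_def)
  obtain F' where F': "F' \<in> carrier_mat n n" "map_mat h F' = F" using lift_mat[OF assms(2)] .
  interpret L: idempotent_lift R h F' n
    by unfold_locales (use F' assms(3) mat_prod[OF F'(1) F'(1)] in auto)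
  have cp: "charpoly R F = H (det (pencil F' [:0, 1:] ([:0, 1:] - 1)))"
    using charpoly_eq[OF F'(1)] unfolding pencil_charmat[OF F'(1)] F'(2) .
  have nil_if_rank: "poly_eq_mod_nil R (charpoly R F) (rank_charpoly R k n)"
    if "constant_rank R (image_mod R F) k"
  proof (cases "\<one>\<^bsub>R\<^esub> = \<zero>\<^bsub>R\<^esub>")
    \<comment> \<open>In the trivial ring the rank says nothing about \<open>F\<close>, but everything is nilpotent.\<close>
    case True
    then have "nilpotent R x" if "x \<in> carrier R" for x
      using that one_zeroD[of] by (auto simp: nilpotent_def intro: exI[of _ "1::nat"])
    then show ?thesis unfolding cp rank_charpoly_eq poly_eq_mod_nil_H by blast
  next
    case False
    have "mod_isomorphic R (image_mod R F) (image_mod R F)"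
      unfolding mod_isomorphic_def mod_hom_def by (intro bexI[of _ "\<lambda>x. x"]) (auto simp: bij_betw_def)
    then show ?thesis using that False proj unfolding constant_rank_def by blast
  qed
  have idem: "h (pencil_coeff F' j) = (if j = k then \<one>\<^bsub>R\<^esub> else \<zero>\<^bsub>R\<^esub>)"
    if "poly_eq_mod_nil R (charpoly R F) (rank_charpoly R k n)" "j \<le> n" for j
    using L.rank_determines_idempotents[OF assms(4) that(2)] that(1)
    unfolding cp rank_charpoly_eq poly_eq_mod_nil_H by blast
  have rank_imp: "charpoly R F = rank_charpoly R k n" if "constant_rank R (image_mod R F) k"
    using L.charpoly_eq_rank_poly[OF assms(4) idem[OF nil_if_rank[OF that]]]
    unfolding cp rank_charpoly_eq .
  have imp_rank: "constant_rank R (image_mod R F) k" if eq: "charpoly R F = rank_charpoly R k n"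
    unfolding constant_rank_def
  proof (intro conjI impI allI ballI)
    show "fg_projective R (image_mod R F)" by (rule image_fg_projective[OF proj])
    fix m G
    assume ne: "\<one>\<^bsub>R\<^esub> \<noteq> \<zero>\<^bsub>R\<^esub>" and G: "G \<in> projections R m"
      and iso: "mod_isomorphic R (image_mod R G) (image_mod R F)"
    obtain P Q where PQ: "P \<in> matrices R m n" "Q \<in> matrices R n m"
      "mat_prod R P Q = G" "mat_prod R Q P = F"
      using isomorphic_images_factor[OF G proj iso] .
    obtain P' where P': "P' \<in> carrier_mat m n" "map_mat h P' = P" using lift_mat[OF PQ(1)] .
    obtain Q' where Q': "Q' \<in> carrier_mat n m" "map_mat h Q' = Q" using lift_mat[OF PQ(2)] .
    have *: "map_mat h (P' * Q') = G" "map_mat h (Q' * P') = F"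
      using PQ P' Q' by (simp_all add: mat_prod[OF P'(1) Q'(1)] mat_prod[OF Q'(1) P'(1)])
    have "k \<le> m \<and> charpoly R G = rank_charpoly R k m"
      using charpoly_factors_swapped[OF P'(1) Q'(1) assms(4) ne] eq unfolding * .
    moreover have "poly_eq_mod_nil R (rank_charpoly R k m) (rank_charpoly R k m)"
      unfolding rank_charpoly_eq poly_eq_mod_nil_H
      by (auto simp: zero nilpotent_def intro: exI[of _ "1::nat"])
    ultimately show "k \<le> m" "poly_eq_mod_nil R (charpoly R G) (rank_charpoly R k m)" by simp_all
  qed
  have minors: "mat_det R (submatrix F I J) = \<zero>\<^bsub>R\<^esub>"
    if "constant_rank R (image_mod R F) k" "I \<subseteq> {..<n}" "J \<subseteq> {..<n}" "card I = k + 1" "card J = k + 1" for I J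
    using L.minor_zero[OF assms(4) idem[OF nil_if_rank[OF that(1)]] that(2,4,3,5)] F'(2) by simp
  show ?thesis using rank_imp imp_rank minors by blast
qed

end
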